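(* Let $(\overline{M},(\varphi_\alpha,\xi_\alpha,\eta_\alpha)_{\alpha=1,2,3},\overline{g})$ be a mixed 3-Sasakian manifold and let $M$ be a non-degenerate submanifold of $\overline{M}$, tangent to the structure vector fields $\xi_1,\xi_2,\xi_3$. Then $M$ is totally geodesic if and only if it is invariant.
   Context: Set $\tau_1=\tau_2=-1$, $\tau_3=1$. A mixed 3-structure on a smooth manifold $\overline{M}$ is a triple $(\varphi_\alpha,\xi_\alpha,\eta_\alpha)$, $\alpha=1,2,3$, where $\varphi_\alpha$ is a $(1,1)$-tensor field, $\xi_\alpha$ a vector field, $\eta_\alpha$ a 1-form, such that $\varphi_\alpha^2=\tau_\alpha(-I+\eta_\alpha\otimes\xi_\alpha)$, $\eta_\alpha(\xi_\alpha)=1$ (hence $\varphi_\alpha\xi_\alpha=0$, $\eta_\alpha\circ\varphi_\alpha=0$), and for every even permutation $(\alpha,\beta,\gamma)$ of $(1,2,3)$: $\eta_\alpha(\xi_\beta)=\eta_\beta(\xi_\alpha)=0$; $\varphi_\alpha(\xi_\beta)=\tau_\beta\xi_\gamma$, $\varphi_\beta(\xi_\alpha)=-\tau_\alpha\xi_\gamma$; $\eta_\alpha\circ\varphi_\beta=-\eta_\beta\circ\varphi_\alpha=\tau_\gamma\eta_\gamma$; $\varphi_\alpha\varphi_\beta-\tau_\alpha\eta_\beta\otimes\xi_\alpha=-\varphi_\beta\varphi_\alpha+\tau_\beta\eta_\alpha\otimes\xi_\beta=\tau_\gamma\varphi_\gamma$. It is a metric mixed 3-structure if in addition there is given a semi-Riemannian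 metric $\overline{g}$ with $\overline{g}(\varphi_\alpha X,\varphi_\alpha Y)=\tau_\alpha[\overline{g}(X,Y)-\varepsilon_\alpha\eta_\alpha(X)\eta_\alpha(Y)]$ for all $X,Y$ and $\alpha=1,2,3$, where $\varepsilon_\alpha=\overline{g}(\xi_\alpha,\xi_\alpha)=\pm1$. Consequently $\eta_\alpha(X)=\varepsilon_\alpha\overline{g}(X,\xi_\alpha)$ and $\overline{g}(\varphi_\alpha X,Y)=-\overline{g}(X,\varphi_\alpha Y)$. With $\overline\nabla$ the Levi-Civita connection of $\overline g$, the structure is mixed 3-Sasakian if $(\overline\nabla_X\varphi_\alpha)Y=\tau_\alpha[\overline g(X,Y)\xi_\alpha-\varepsilon_\alpha\eta_\alpha(Y)X]$ for all $X,Y$ and $\alpha=1,2,3$ (it follows that $\overline\nabla_X\xi_\alpha=-\varepsilon_\alpha\varphi_\alpha X$). A submanifold $M$ (immersed) is non-degenerate if the restriction of $\overline g$ to $TM$ is non-degenerate at each point; it is totally geodesic if its second fundamental form vanishes; it is invariant if $\varphi_\alpha(T_pM)\subset T_pM$ for all $p\in M$, $\alpha=1,2,3$. "Tangent to the structure vector fields" means $\xi_{\alpha,p}\in T_pM$ for all $p\in M$, $\alpha=1,2,3$. *)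

theory Defs
  imports "HOL-Analysis.Analysis" "HOL-Library.Function_Algebras"
begin

section \<open>Smooth manifolds\<close>

text \<open>Meant for open \<open>S\<close> only; \<open>C_k k f S\<close> says that all iterated directional derivatives of \<open>f\<close>
  of order at most \<open>k\<close> exist as Frechet derivatives and are continuous.\<close>

fun C_k :: "nat \<Rightarrow> ('a::real_normed_vector \<Rightarrow> 'b::real_normed_vector) \<Rightarrow> 'a set \<Rightarrow> bool" where
  "C_k 0 f S \<longleftrightarrow> continuous_on S f"
| "C_k (Suc k) f S \<longleftrightarrow> (\<forall>x\<in>S. f differentiable at x) \<and>
     (\<forall>v. C_k k (\<lambda>x. frechet_derivative f (at x) v) S)"

definition smooth_on :: "'a::real_normed_vector set \<Rightarrow> ('a \<Rightarrow> 'b::real_normed_vector) \<Rightarrow> bool" where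
  "smooth_on S f \<longleftrightarrow> (\<forall>k. C_k k f S)"

datatype ('m, 'e) chart = Chart (chart_dom: "'m set") (chart_map: "'m \<Rightarrow> 'e")

definition chart_inv :: "('m, 'e) chart \<Rightarrow> 'e \<Rightarrow> 'm" where
  "chart_inv c = inv_into (chart_dom c) (chart_map c)"

definition is_chart :: "('m::topological_space, 'e::euclidean_space) chart \<Rightarrow> bool" where
  "is_chart c \<longleftrightarrow> open (chart_dom c) \<and> open (chart_map c ` chart_dom c) \<and>
     homeomorphism (chart_dom c) (chart_map c ` chart_dom c) (chart_map c) (chart_inv c)"

text \<open>A manifold is a whole type \<open>'m\<close> with a smooth atlas. Dimension zero, which is excluded
  because every \<open>euclidean_space\<close> has positive dimension, cannot occur for a manifold carrying
  (or tangent to) three linearly independent vector fields.\<close>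

definition smooth_manifold ::
  "('m::{t2_space,second_countable_topology}, 'e::euclidean_space) chart set \<Rightarrow> bool" where
  "smooth_manifold A \<longleftrightarrow>
     (\<forall>c\<in>A. is_chart c) \<and> (\<Union>c\<in>A. chart_dom c) = UNIV \<and>
     (\<forall>c\<in>A. \<forall>c'\<in>A. smooth_on (chart_map c ` (chart_dom c \<inter> chart_dom c')) (chart_map c' \<circ> chart_inv c))"

definition charts_at :: "('m, 'e) chart set \<Rightarrow> 'm \<Rightarrow> ('m, 'e) chart set" where
  "charts_at A p = {c \<in> A. p \<in> chart_dom c}"

definition chart_at :: "('m, 'e) chart set \<Rightarrow> 'm \<Rightarrow> ('m, 'e) chart" where
  "chart_at A p = (SOME c. c \<in> charts_at A p)"

definition smooth_fun ::
  "('m::topological_space, 'e::euclidean_space) chart set \<Rightarrow> 'm set \<Rightarrow> ('m \<Rightarrow> real) \<Rightarrow> bool" where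
  "smooth_fun A U h \<longleftrightarrow> (\<forall>c\<in>A. smooth_on (chart_map c ` (chart_dom c \<inter> U)) (h \<circ> chart_inv c))"

definition smooth_map ::
  "('s::topological_space, 'd::euclidean_space) chart set \<Rightarrow>
   ('m::topological_space, 'e::euclidean_space) chart set \<Rightarrow> ('s \<Rightarrow> 'm) \<Rightarrow> bool" where
  "smooth_map B A f \<longleftrightarrow> continuous_on UNIV f \<and>
     (\<forall>b\<in>B. \<forall>c\<in>A. smooth_on (chart_map b ` (chart_dom b \<inter> f -` chart_dom c))
                          (chart_map c \<circ> f \<circ> chart_inv b))"


section \<open>Tangent vectors and vector fields\<close>

instantiation "fun" :: (type, real_vector) real_vector
begin

definition scaleR_fun :: "real \<Rightarrow> ('a \<Rightarrow> 'b) \<Rightarrow> 'a \<Rightarrow> 'b" where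
  "scaleR_fun r f = (\<lambda>x. r *\<^sub>R f x)"

instance
  by standard (auto simp: scaleR_fun_def fun_eq_iff scaleR_add_right scaleR_add_left)

end

text \<open>A tangent vector at \<open>p\<close> is an equivalence class of pairs (chart around \<open>p\<close>, vector of the model
  space) modulo the derivatives of the coordinate changes. Such a class contains exactly one vector
  for each chart around \<open>p\<close>, so it is encoded as the function sending a chart to the components
  in this chart, with value 0 on everything that is not a chart around \<open>p\<close>.\<close>

type_synonym ('m, 'e) tvec = "('m, 'e) chart \<Rightarrow> 'e"

definition tangent_space ::
  "('m::topological_space, 'e::euclidean_space) chart set \<Rightarrow> 'm \<Rightarrow> ('m, 'e) tvec set" where
  "tangent_space A p = {v.
     (\<forall>c\<in>charts_at A p. \<forall>c'\<in>charts_at A p.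
        v c' = frechet_derivative (chart_map c' \<circ> chart_inv c) (at (chart_map c p)) (v c)) \<and>
     (\<forall>c. c \<notin> charts_at A p \<longrightarrow> v c = 0)}"

text \<open>The tangent vector at \<open>p\<close> with components \<open>x\<close> in the chart \<open>c\<close>.\<close>

definition tangent_vector ::
  "('m::topological_space, 'e::euclidean_space) chart set \<Rightarrow> ('m, 'e) chart \<Rightarrow> 'm \<Rightarrow> 'e \<Rightarrow> ('m, 'e) tvec" where
  "tangent_vector A c p x = (\<lambda>c'. if c' \<in> charts_at A p
     then frechet_derivative (chart_map c' \<circ> chart_inv c) (at (chart_map c p)) x else 0)"

definition directional_derivative ::
  "('m::topological_space, 'e::euclidean_space) chart set \<Rightarrow> 'm \<Rightarrow> ('m, 'e) tvec \<Rightarrow> ('m \<Rightarrow> real) \<Rightarrow> real" where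
  "directional_derivative A p v h =
     (let c = chart_at A p in frechet_derivative (h \<circ> chart_inv c) (at (chart_map c p)) (v c))"

definition differential ::
  "('s::topological_space, 'd::euclidean_space) chart set \<Rightarrow>
   ('m::topological_space, 'e::euclidean_space) chart set \<Rightarrow> ('s \<Rightarrow> 'm) \<Rightarrow>
   's \<Rightarrow> ('s, 'd) tvec \<Rightarrow> ('m, 'e) tvec" where
  "differential B A f p u =
     (let b = chart_at B p; c = chart_at A (f p) in
       tangent_vector A c (f p)
         (frechet_derivative (chart_map c \<circ> f \<circ> chart_inv b) (at (chart_map b p)) (u b)))"

text \<open>Smooth vector fields on an open set \<open>U\<close>; values outside \<open>U\<close> are irrelevant.\<close>

definition vector_field ::
  "('m::topological_space, 'e::euclidean_space) chart set \<Rightarrow> 'm set \<Rightarrow> ('m \<Rightarrow> ('m, 'e) tvec) \<Rightarrow> bool" where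
  "vector_field A U X \<longleftrightarrow> (\<forall>p\<in>U. X p \<in> tangent_space A p) \<and>
     (\<forall>c\<in>A. smooth_on (chart_map c ` (chart_dom c \<inter> U)) (\<lambda>y. X (chart_inv c y) c))"

definition lie_bracket ::
  "('m::topological_space, 'e::euclidean_space) chart set \<Rightarrow> ('m \<Rightarrow> ('m, 'e) tvec) \<Rightarrow>
   ('m \<Rightarrow> ('m, 'e) tvec) \<Rightarrow> 'm \<Rightarrow> ('m, 'e) tvec" where
  "lie_bracket A X Y p = (\<lambda>c. if c \<in> charts_at A p
     then frechet_derivative (\<lambda>y. Y (chart_inv c y) c) (at (chart_map c p)) (X p c)
        - frechet_derivative (\<lambda>y. X (chart_inv c y) c) (at (chart_map c p)) (Y p c)
     else 0)"


section \<open>Tensor fields, metrics and connections\<close>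

definition tensor_field_11 ::
  "('m::topological_space, 'e::euclidean_space) chart set \<Rightarrow>
   ('m \<Rightarrow> ('m, 'e) tvec \<Rightarrow> ('m, 'e) tvec) \<Rightarrow> bool" where
  "tensor_field_11 A F \<longleftrightarrow>
     (\<forall>p. \<forall>u\<in>tangent_space A p. F p u \<in> tangent_space A p) \<and>
     (\<forall>p r. \<forall>u\<in>tangent_space A p. \<forall>v\<in>tangent_space A p.
        F p (u + v) = F p u + F p v \<and> F p (r *\<^sub>R u) = r *\<^sub>R F p u) \<and>
     (\<forall>U X. open U \<longrightarrow> vector_field A U X \<longrightarrow> vector_field A U (\<lambda>p. F p (X p)))"

definition one_form ::
  "('m::topological_space, 'e::euclidean_space) chart set \<Rightarrow>
   ('m \<Rightarrow> ('m, 'e) tvec \<Rightarrow> real) \<Rightarrow> bool" where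
  "one_form A w \<longleftrightarrow>
     (\<forall>p r. \<forall>u\<in>tangent_space A p. \<forall>v\<in>tangent_space A p.
        w p (u + v) = w p u + w p v \<and> w p (r *\<^sub>R u) = r * w p u) \<and>
     (\<forall>U X. open U \<longrightarrow> vector_field A U X \<longrightarrow> smooth_fun A U (\<lambda>p. w p (X p)))"

definition semi_riemannian_metric ::
  "('m::topological_space, 'e::euclidean_space) chart set \<Rightarrow>
   ('m \<Rightarrow> ('m, 'e) tvec \<Rightarrow> ('m, 'e) tvec \<Rightarrow> real) \<Rightarrow> bool" where
  "semi_riemannian_metric A g \<longleftrightarrow>
     (\<forall>p r. \<forall>u\<in>tangent_space A p. \<forall>v\<in>tangent_space A p. \<forall>w\<in>tangent_space A p.
        g p (u + v) w = g p u w + g p v w \<and> g p (r *\<^sub>R u) w = r * g p u w \<and> g p u w = g p w u) \<and>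
     (\<forall>p. \<forall>u\<in>tangent_space A p. (\<forall>v\<in>tangent_space A p. g p u v = 0) \<longrightarrow> u = 0) \<and>
     (\<forall>U X Y. open U \<longrightarrow> vector_field A U X \<longrightarrow> vector_field A U Y \<longrightarrow>
        smooth_fun A U (\<lambda>p. g p (X p) (Y p)))"

text \<open>\<open>nabla p v Y\<close> is the covariant derivative at \<open>p\<close> in direction \<open>v\<close> of a vector field \<open>Y\<close> which
  is smooth on some open neighbourhood \<open>U\<close> of \<open>p\<close>. The Leibniz rule is required for all functions
  smooth on \<open>U\<close>; with the indicator function of \<open>U\<close> it makes \<open>nabla p v Y\<close> depend only on
  the restriction of \<open>Y\<close> to \<open>U\<close>.\<close>

type_synonym ('m, 'e) conn = "'m \<Rightarrow> ('m, 'e) tvec \<Rightarrow> ('m \<Rightarrow> ('m, 'e) tvec) \<Rightarrow> ('m, 'e) tvec"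

definition affine_connection ::
  "('m::topological_space, 'e::euclidean_space) chart set \<Rightarrow> ('m, 'e) conn \<Rightarrow> bool" where
  "affine_connection A nabla \<longleftrightarrow>
     (\<forall>U Y. open U \<longrightarrow> vector_field A U Y \<longrightarrow>
        (\<forall>p\<in>U. \<forall>u\<in>tangent_space A p. nabla p u Y \<in> tangent_space A p) \<and>
        (\<forall>p\<in>U. \<forall>r. \<forall>u\<in>tangent_space A p. \<forall>v\<in>tangent_space A p.
           nabla p (u + v) Y = nabla p u Y + nabla p v Y \<and>
           nabla p (r *\<^sub>R u) Y = r *\<^sub>R nabla p u Y) \<and>
        (\<forall>Z. vector_field A U Z \<longrightarrow> (\<forall>p\<in>U. \<forall>u\<in>tangent_space A p.
           nabla p u (\<lambda>q. Y q + Z q) = nabla p u Y + nabla p u Z)) \<and>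
        (\<forall>h. smooth_fun A U h \<longrightarrow> (\<forall>p\<in>U. \<forall>u\<in>tangent_space A p.
           nabla p u (\<lambda>q. h q *\<^sub>R Y q) =
             directional_derivative A p u h *\<^sub>R Y p + h p *\<^sub>R nabla p u Y)) \<and>
        (\<forall>X. vector_field A U X \<longrightarrow> vector_field A U (\<lambda>q. nabla q (X q) Y)))"

definition levi_civita_connection ::
  "('m::topological_space, 'e::euclidean_space) chart set \<Rightarrow>
   ('m \<Rightarrow> ('m, 'e) tvec \<Rightarrow> ('m, 'e) tvec \<Rightarrow> real) \<Rightarrow> ('m, 'e) conn \<Rightarrow> bool" where
  "levi_civita_connection A g nabla \<longleftrightarrow> affine_connection A nabla \<and>
     (\<forall>U X Y. open U \<longrightarrow> vector_field A U X \<longrightarrow> vector_field A U Y \<longrightarrow>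
        (\<forall>p\<in>U. nabla p (X p) Y - nabla p (Y p) X = lie_bracket A X Y p) \<and>
        (\<forall>p\<in>U. \<forall>u\<in>tangent_space A p.
           directional_derivative A p u (\<lambda>q. g q (X q) (Y q)) =
             g p (nabla p u X) (Y p) + g p (X p) (nabla p u Y)))"


section \<open>Mixed 3-structures\<close>

definition tau :: "nat \<Rightarrow> real" where
  "tau \<alpha> = (if \<alpha> = 3 then 1 else -1)"

definition even_perms :: "(nat \<times> nat \<times> nat) set" where
  "even_perms = {(1, 2, 3), (2, 3, 1), (3, 1, 2)}"

definition mixed_3_structure ::
  "('m::topological_space, 'e::euclidean_space) chart set \<Rightarrow>
   (nat \<Rightarrow> 'm \<Rightarrow> ('m, 'e) tvec \<Rightarrow> ('m, 'e) tvec) \<Rightarrow> (nat \<Rightarrow> 'm \<Rightarrow> ('m, 'e) tvec) \<Rightarrow>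
   (nat \<Rightarrow> 'm \<Rightarrow> ('m, 'e) tvec \<Rightarrow> real) \<Rightarrow> bool" where
  "mixed_3_structure A \<phi> \<xi> \<eta> \<longleftrightarrow>
     (\<forall>\<alpha>\<in>{1,2,3}. tensor_field_11 A (\<phi> \<alpha>) \<and> vector_field A UNIV (\<xi> \<alpha>) \<and> one_form A (\<eta> \<alpha>)) \<and>
     (\<forall>\<alpha>\<in>{1,2,3}. \<forall>p. \<eta> \<alpha> p (\<xi> \<alpha> p) = 1 \<and>
        (\<forall>u\<in>tangent_space A p. \<phi> \<alpha> p (\<phi> \<alpha> p u) = tau \<alpha> *\<^sub>R (- u + \<eta> \<alpha> p u *\<^sub>R \<xi> \<alpha> p))) \<and>
     (\<forall>(\<alpha>, \<beta>, \<gamma>)\<in>even_perms. \<forall>p.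
        \<eta> \<alpha> p (\<xi> \<beta> p) = 0 \<and> \<eta> \<beta> p (\<xi> \<alpha> p) = 0 \<and>
        \<phi> \<alpha> p (\<xi> \<beta> p) = tau \<beta> *\<^sub>R \<xi> \<gamma> p \<and> \<phi> \<beta> p (\<xi> \<alpha> p) = - tau \<alpha> *\<^sub>R \<xi> \<gamma> p \<and>
        (\<forall>u\<in>tangent_space A p.
           \<eta> \<alpha> p (\<phi> \<beta> p u) = tau \<gamma> * \<eta> \<gamma> p u \<and>
           - \<eta> \<beta> p (\<phi> \<alpha> p u) = tau \<gamma> * \<eta> \<gamma> p u \<and>
           \<phi> \<alpha> p (\<phi> \<beta> p u) - (tau \<alpha> * \<eta> \<beta> p u) *\<^sub>R \<xi> \<alpha> p = tau \<gamma> *\<^sub>R \<phi> \<gamma> p u \<and>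
           - \<phi> \<beta> p (\<phi> \<alpha> p u) + (tau \<beta> * \<eta> \<alpha> p u) *\<^sub>R \<xi> \<beta> p = tau \<gamma> *\<^sub>R \<phi> \<gamma> p u))"

definition metric_mixed_3_structure ::
  "('m::topological_space, 'e::euclidean_space) chart set \<Rightarrow>
   (nat \<Rightarrow> 'm \<Rightarrow> ('m, 'e) tvec \<Rightarrow> ('m, 'e) tvec) \<Rightarrow> (nat \<Rightarrow> 'm \<Rightarrow> ('m, 'e) tvec) \<Rightarrow>
   (nat \<Rightarrow> 'm \<Rightarrow> ('m, 'e) tvec \<Rightarrow> real) \<Rightarrow>
   ('m \<Rightarrow> ('m, 'e) tvec \<Rightarrow> ('m, 'e) tvec \<Rightarrow> real) \<Rightarrow> (nat \<Rightarrow> real) \<Rightarrow> bool" where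
  "metric_mixed_3_structure A \<phi> \<xi> \<eta> g \<epsilon> \<longleftrightarrow>
     mixed_3_structure A \<phi> \<xi> \<eta> \<and> semi_riemannian_metric A g \<and>
     (\<forall>\<alpha>\<in>{1,2,3}. \<epsilon> \<alpha> \<in> {1, -1} \<and> (\<forall>p. g p (\<xi> \<alpha> p) (\<xi> \<alpha> p) = \<epsilon> \<alpha>) \<and>
        (\<forall>p. \<forall>u\<in>tangent_space A p. \<forall>v\<in>tangent_space A p.
           g p (\<phi> \<alpha> p u) (\<phi> \<alpha> p v) = tau \<alpha> * (g p u v - \<epsilon> \<alpha> * \<eta> \<alpha> p u * \<eta> \<alpha> p v)))"

definition cov_deriv_tensor ::
  "('m, 'e::euclidean_space) conn \<Rightarrow> ('m \<Rightarrow> ('m, 'e) tvec \<Rightarrow> ('m, 'e) tvec) \<Rightarrow>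
   'm \<Rightarrow> ('m, 'e) tvec \<Rightarrow> ('m \<Rightarrow> ('m, 'e) tvec) \<Rightarrow> ('m, 'e) tvec" where
  "cov_deriv_tensor nabla F p u Y = nabla p u (\<lambda>q. F q (Y q)) - F p (nabla p u Y)"

definition mixed_3_sasakian ::
  "('m::{t2_space,second_countable_topology}, 'e::euclidean_space) chart set \<Rightarrow>
   (nat \<Rightarrow> 'm \<Rightarrow> ('m, 'e) tvec \<Rightarrow> ('m, 'e) tvec) \<Rightarrow> (nat \<Rightarrow> 'm \<Rightarrow> ('m, 'e) tvec) \<Rightarrow>
   (nat \<Rightarrow> 'm \<Rightarrow> ('m, 'e) tvec \<Rightarrow> real) \<Rightarrow>
   ('m \<Rightarrow> ('m, 'e) tvec \<Rightarrow> ('m, 'e) tvec \<Rightarrow> real) \<Rightarrow> (nat \<Rightarrow> real) \<Rightarrow> ('m, 'e) conn \<Rightarrow> bool" where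
  "mixed_3_sasakian A \<phi> \<xi> \<eta> g \<epsilon> nabla \<longleftrightarrow>
     smooth_manifold A \<and> metric_mixed_3_structure A \<phi> \<xi> \<eta> g \<epsilon> \<and> levi_civita_connection A g nabla \<and>
     (\<forall>\<alpha>\<in>{1,2,3}. \<forall>U Y. open U \<longrightarrow> vector_field A U Y \<longrightarrow>
        (\<forall>p\<in>U. \<forall>u\<in>tangent_space A p.
           cov_deriv_tensor nabla (\<phi> \<alpha>) p u Y =
             tau \<alpha> *\<^sub>R (g p u (Y p) *\<^sub>R \<xi> \<alpha> p - (\<epsilon> \<alpha> * \<eta> \<alpha> p (Y p)) *\<^sub>R u)))"


section \<open>Submanifolds\<close>

text \<open>A submanifold is given by an immersion \<open>f\<close> of a manifold, with atlas \<open>B\<close>, into the ambient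
  manifold, with atlas \<open>A\<close>.\<close>

definition immersed_submanifold ::
  "('s::{t2_space,second_countable_topology}, 'd::euclidean_space) chart set \<Rightarrow>
   ('m::{t2_space,second_countable_topology}, 'e::euclidean_space) chart set \<Rightarrow> ('s \<Rightarrow> 'm) \<Rightarrow> bool" where
  "immersed_submanifold B A f \<longleftrightarrow> smooth_manifold B \<and> smooth_map B A f \<and>
     (\<forall>p. inj_on (differential B A f p) (tangent_space B p))"

text \<open>The tangent space of the submanifold at \<open>p\<close> as a subspace of the ambient tangent space.\<close>

definition sub_tangent ::
  "('s::topological_space, 'd::euclidean_space) chart set \<Rightarrow>
   ('m::topological_space, 'e::euclidean_space) chart set \<Rightarrow> ('s \<Rightarrow> 'm) \<Rightarrow> 's \<Rightarrow> ('m, 'e) tvec set" where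
  "sub_tangent B A f p = differential B A f p ` tangent_space B p"

definition sub_normal ::
  "('s::topological_space, 'd::euclidean_space) chart set \<Rightarrow>
   ('m::topological_space, 'e::euclidean_space) chart set \<Rightarrow>
   ('m \<Rightarrow> ('m, 'e) tvec \<Rightarrow> ('m, 'e) tvec \<Rightarrow> real) \<Rightarrow> ('s \<Rightarrow> 'm) \<Rightarrow> 's \<Rightarrow> ('m, 'e) tvec set" where
  "sub_normal B A g f p =
     {n \<in> tangent_space A (f p). \<forall>w\<in>sub_tangent B A f p. g (f p) n w = 0}"

definition nondegenerate_submanifold ::
  "('s::topological_space, 'd::euclidean_space) chart set \<Rightarrow>
   ('m::topological_space, 'e::euclidean_space) chart set \<Rightarrow>
   ('m \<Rightarrow> ('m, 'e) tvec \<Rightarrow> ('m, 'e) tvec \<Rightarrow> real) \<Rightarrow> ('s \<Rightarrow> 'm) \<Rightarrow> bool" where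
  "nondegenerate_submanifold B A g f \<longleftrightarrow>
     (\<forall>p. \<forall>u\<in>sub_tangent B A f p. (\<forall>w\<in>sub_tangent B A f p. g (f p) u w = 0) \<longrightarrow> u = 0)"

definition normal_part ::
  "('s::topological_space, 'd::euclidean_space) chart set \<Rightarrow>
   ('m::topological_space, 'e::euclidean_space) chart set \<Rightarrow>
   ('m \<Rightarrow> ('m, 'e) tvec \<Rightarrow> ('m, 'e) tvec \<Rightarrow> real) \<Rightarrow> ('s \<Rightarrow> 'm) \<Rightarrow> 's \<Rightarrow>
   ('m, 'e) tvec \<Rightarrow> ('m, 'e) tvec" where
  "normal_part B A g f p z =
     (THE n. n \<in> sub_normal B A g f p \<and> z - n \<in> sub_tangent B A f p)"

text \<open>The connection induced on vector fields \<open>V\<close> along \<open>f\<close>: in a chart around \<open>f p\<close> with coordinate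
  frame \<open>E i\<close> write \<open>V = (\<Sum>i. V\<^sup>i (E i \<circ> f))\<close>, and then
  \<open>nabla\<^sub>u V = (\<Sum>i. u(V\<^sup>i) E i + V\<^sup>i nabla\<^bsub>df u\<^esub> (E i))\<close>. This is independent
  of the chart, and equals \<open>nabla\<^bsub>df u\<^esub> Y\<close> whenever \<open>V = Y \<circ> f\<close> near \<open>p\<close>, i.e. for every local
  extension \<open>Y\<close> of \<open>V\<close>.\<close>

definition induced_connection ::
  "('s::topological_space, 'd::euclidean_space) chart set \<Rightarrow>
   ('m::topological_space, 'e::euclidean_space) chart set \<Rightarrow> ('m, 'e) conn \<Rightarrow> ('s \<Rightarrow> 'm) \<Rightarrow>
   's \<Rightarrow> ('s, 'd) tvec \<Rightarrow> ('s \<Rightarrow> ('m, 'e) tvec) \<Rightarrow> ('m, 'e) tvec" where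
  "induced_connection B A nabla f p u V =
     (let c = chart_at A (f p); E = (\<lambda>i q. tangent_vector A c q i) in
       \<Sum>i\<in>Basis. directional_derivative B p u (\<lambda>q. V q c \<bullet> i) *\<^sub>R E i (f p)
                + (V p c \<bullet> i) *\<^sub>R nabla (f p) (differential B A f p u) (E i))"

definition second_fundamental_form ::
  "('s::topological_space, 'd::euclidean_space) chart set \<Rightarrow>
   ('m::topological_space, 'e::euclidean_space) chart set \<Rightarrow>
   ('m \<Rightarrow> ('m, 'e) tvec \<Rightarrow> ('m, 'e) tvec \<Rightarrow> real) \<Rightarrow> ('m, 'e) conn \<Rightarrow> ('s \<Rightarrow> 'm) \<Rightarrow>
   ('s \<Rightarrow> ('s, 'd) tvec) \<Rightarrow> ('s \<Rightarrow> ('s, 'd) tvec) \<Rightarrow> 's \<Rightarrow> ('m, 'e) tvec" where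
  "second_fundamental_form B A g nabla f X Y p =
     normal_part B A g f p
       (induced_connection B A nabla f p (X p) (\<lambda>q. differential B A f q (Y q)))"

definition totally_geodesic ::
  "('s::topological_space, 'd::euclidean_space) chart set \<Rightarrow>
   ('m::topological_space, 'e::euclidean_space) chart set \<Rightarrow>
   ('m \<Rightarrow> ('m, 'e) tvec \<Rightarrow> ('m, 'e) tvec \<Rightarrow> real) \<Rightarrow> ('m, 'e) conn \<Rightarrow> ('s \<Rightarrow> 'm) \<Rightarrow> bool" where
  "totally_geodesic B A g nabla f \<longleftrightarrow>
     (\<forall>V X Y. open V \<longrightarrow> vector_field B V X \<longrightarrow> vector_field B V Y \<longrightarrow>
        (\<forall>p\<in>V. second_fundamental_form B A g nabla f X Y p = 0))"

definition tangent_to_structure_fields ::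
  "('s::topological_space, 'd::euclidean_space) chart set \<Rightarrow>
   ('m::topological_space, 'e::euclidean_space) chart set \<Rightarrow>
   (nat \<Rightarrow> 'm \<Rightarrow> ('m, 'e) tvec) \<Rightarrow> ('s \<Rightarrow> 'm) \<Rightarrow> bool" where
  "tangent_to_structure_fields B A \<xi> f \<longleftrightarrow>
     (\<forall>p. \<forall>\<alpha>\<in>{1,2,3}. \<xi> \<alpha> (f p) \<in> sub_tangent B A f p)"

definition invariant_submanifold ::
  "('s::topological_space, 'd::euclidean_space) chart set \<Rightarrow>
   ('m::topological_space, 'e::euclidean_space) chart set \<Rightarrow>
   (nat \<Rightarrow> 'm \<Rightarrow> ('m, 'e) tvec \<Rightarrow> ('m, 'e) tvec) \<Rightarrow> ('s \<Rightarrow> 'm) \<Rightarrow> bool" where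
  "invariant_submanifold B A \<phi> f \<longleftrightarrow>
     (\<forall>p. \<forall>\<alpha>\<in>{1,2,3}. \<phi> \<alpha> (f p) ` sub_tangent B A f p \<subseteq> sub_tangent B A f p)"

end

theory Submission
  imports Defs
begin

text \<open>Write \<open>h\<close> for the second fundamental form of the submanifold, taken modulo tangent vectors; it is
  symmetric and tensorial. If it vanishes, \<open>nabla\<^sub>u \<xi>\<^sub>\<alpha>\<close> is tangent for every tangent \<open>u\<close>, because
  \<open>\<xi>\<^sub>\<alpha>\<close> is. The Sasaki equation for the field \<open>\<xi>\<^sub>\<alpha>\<close>, for which \<open>\<phi>\<^sub>\<alpha> \<xi>\<^sub>\<alpha> = 0\<close>, expresses \<open>\<phi>\<^sub>\<alpha> u\<close>
  through \<open>\<phi>\<^sub>\<alpha>\<^sup>2 nabla\<^sub>u \<xi>\<^sub>\<alpha>\<close>, which is therefore tangent as well.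

  Conversely, if the tangent spaces are invariant, the Sasaki equation gives
  \<open>h (u, \<phi>\<^sub>\<alpha> v) = \<phi>\<^sub>\<alpha> h (u, v)\<close> modulo tangent vectors. By symmetry \<open>h (\<phi>\<^sub>1 u, \<phi>\<^sub>2 v)\<close> equals both
  \<open>\<phi>\<^sub>1 \<phi>\<^sub>2 h (u, v)\<close> and \<open>\<phi>\<^sub>2 \<phi>\<^sub>1 h (u, v)\<close>. As \<open>\<phi>\<^sub>1\<close> and \<open>\<phi>\<^sub>2\<close> anticommute modulo tangent vectors,
  with product \<open>\<phi>\<^sub>3\<close>, the vector \<open>\<phi>\<^sub>3 h (u, v)\<close> is tangent, and so is \<open>h (u, v)\<close>.\<close>

section \<open>Calculus in Euclidean spaces\<close>

text \<open>A tangent field of the submanifold comes with no ambient extension, and differentiating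
  a normal projection is awkward. Both are avoided by working at one point in one pair of charts:
  there the immersion is a map \<open>F\<close> with derivative \<open>J\<close>, the tangent space
  is the range of \<open>J x0\<close>, and the second fundamental form modulo tangent vectors is the
  second derivative of \<open>F\<close> plus a Christoffel term. Vanishing of a normal part becomes
  membership in that range, and this is where nondegeneracy enters. One difficulty remains. For
  fields such as \<open>\<xi> \<alpha> \<circ> f\<close> tangency is known only point by point, so
  their coefficients with respect to \<open>J\<close> are not known to be differentiable, or even
  continuous. \<open>tangential_derivative\<close> deals with them. Symmetry of \<open>h\<close>
  comes from commuting second derivatives and from vanishing torsion. It allows one structure tensor
  to act on each slot, so that the order of the two actions does not affect the result.\<close>

lemma C_k_cong:
  assumes "open S" "\<And>x. x \<in> S \<Longrightarrow> f x = g x" "C_k k f S"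
  shows "C_k k g S"
  using assms(2,3)
proof (induction k arbitrary: f g)
  case 0
  then show ?case by (simp add: continuous_on_eq)
next
  case (Suc k)
  have d: "f differentiable at x" if "x \<in> S" for x
    using Suc.prems(2) that by simp
  have D: "frechet_derivative f (at x) = frechet_derivative g (at x)" if "x \<in> S" for x
    using frechet_derivative_transform_within_open[OF d[OF that] assms(1) that] Suc.prems(1) by blast
  have "g differentiable at x" if "x \<in> S" for x
    using d[OF that] has_derivative_transform_within_open[OF _ assms(1) that] Suc.prems(1)
    unfolding differentiable_def by blast
  moreover have "C_k k (\<lambda>x. frechet_derivative g (at x) v) S" for v
    by (rule Suc.IH[of "\<lambda>x. frechet_derivative f (at x) v"]) (use D Suc.prems(2) in auto)
  ultimately show ?case by simp
qed

text \<open>Lets the derivative be given by any convenient formula instead of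
  \<open>frechet_derivative\<close>; the closure properties below then follow from the usual
  differentiation rules.\<close>

lemma C_k_SucI:
  assumes "open S" "\<And>x. x \<in> S \<Longrightarrow> (f has_derivative f' x) (at x)"
    and "\<And>v. C_k k (\<lambda>x. f' x v) S"
  shows "C_k (Suc k) f S"
proof -
  have "C_k k (\<lambda>x. frechet_derivative f (at x) v) S" for v
    by (rule C_k_cong[OF assms(1) _ assms(3)[of v]])
      (use assms(2) frechet_derivative_at in metis)
  then show ?thesis
    using assms(2) by (auto simp: differentiable_def)
qed

lemma C_k_Suc_has_derivative:
  assumes "C_k (Suc k) f S" "x \<in> S"
  shows "(f has_derivative frechet_derivative f (at x)) (at x)"
  using assms frechet_derivative_works by auto

text \<open>The product and chain rules leave one factor undifferentiated, and the inductions need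
  that factor one order lower.\<close>

lemma C_k_Suc_imp_C_k: "C_k (Suc k) f S \<Longrightarrow> C_k k f S"
proof (induction k arbitrary: f)
  case 0
  then show ?case
    by (auto intro!: continuous_at_imp_continuous_on differentiable_imp_continuous_within)
next
  case (Suc k)
  then show ?case by (metis C_k.simps(2))
qed

lemma C_k_subset:
  assumes "T \<subseteq> S" shows "C_k k f S \<Longrightarrow> C_k k f T"
proof (induction k arbitrary: f)
  case 0
  then show ?case using assms by (auto intro: continuous_on_subset)
next
  case (Suc k)
  then show ?case using assms by auto
qed

section \<open>Closure of the class C^k under algebraic operations and composition\<close>

lemma C_k_const:
  assumes "open S" shows "C_k k (\<lambda>x. c) S"
proof (induction k arbitrary: c)
  case (Suc k)
  show ?case by (rule C_k_SucI[OF assms, of _ "\<lambda>x v. 0"]) (auto intro: Suc)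
qed simp

lemma C_k_add:
  assumes "open S" shows "C_k k f S \<Longrightarrow> C_k k g S \<Longrightarrow> C_k k (\<lambda>x. f x + g x) S"
proof (induction k arbitrary: f g)
  case 0
  then show ?case by (auto intro: continuous_on_add)
next
  case (Suc k)
  show ?case
    by (rule C_k_SucI[OF assms has_derivative_add[OF Suc.prems[THEN C_k_Suc_has_derivative]]])
      (use Suc in auto)
qed

lemma C_k_sum:
  assumes "open S" "\<And>i. i \<in> I \<Longrightarrow> C_k k (f i) S"
  shows "C_k k (\<lambda>x. \<Sum>i\<in>I. f i x) S"
  using assms(2)
  by (induction I rule: infinite_finite_induct) (auto intro: C_k_const C_k_add assms(1))

lemma C_k_bounded_linear:
  assumes "open S" "bounded_linear L" shows "C_k k f S \<Longrightarrow> C_k k (\<lambda>x. L (f x)) S"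
proof (induction k arbitrary: f)
  case 0
  then show ?case by (simp add: bounded_linear.continuous_on[OF assms(2)])
next
  case (Suc k)
  show ?case
    by (rule C_k_SucI[OF assms(1) bounded_linear.has_derivative[OF assms(2) Suc.prems[THEN C_k_Suc_has_derivative]]])
      (use Suc in auto)
qed

lemma C_k_scaleR:
  fixes f :: "'a::real_normed_vector \<Rightarrow> real"
  assumes "open S" shows "C_k k f S \<Longrightarrow> C_k k g S \<Longrightarrow> C_k k (\<lambda>x. f x *\<^sub>R g x) S"
proof (induction k arbitrary: f g)
  case 0
  then show ?case by (auto intro: continuous_on_scaleR)
next
  case (Suc k)
  show ?case
    by (rule C_k_SucI[OF assms has_derivative_scaleR[OF Suc.prems[THEN C_k_Suc_has_derivative]]])
      (use Suc.prems Suc.prems[THEN C_k_Suc_imp_C_k] in \<open>auto intro!: C_k_add[OF assms] Suc.IH\<close>)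
qed

text \<open>\<open>C_k\<close> controls derivatives only in fixed directions. This expansion handles
  a derivative applied to a direction that itself varies with the point.\<close>

lemma linear_Basis_expansion:
  fixes x :: "'a::euclidean_space"
  assumes "linear L" shows "L x = (\<Sum>i\<in>Basis. (x \<bullet> i) *\<^sub>R L i)"
  by (metis (no_types, lifting) assms euclidean_representation linear_cmul linear_sum sum.cong)

lemma subspace_mem_iff:
  assumes "subspace S" "x - y \<in> S" shows "x \<in> S \<longleftrightarrow> y \<in> S"
  using subspace_diff[OF assms(1) _ assms(2), of x] subspace_add[OF assms(1) _ assms(2), of y] by auto

text \<open>Induction with \<open>f\<close> fixed and \<open>g\<close> varying: after expansion over
  the basis, the chain rule contains derivatives of \<open>g\<close> in fixed directions, composed
  with the same \<open>f\<close>.\<close>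

lemma C_k_compose:
  fixes f :: "'a::real_normed_vector \<Rightarrow> 'b::euclidean_space"
  assumes "open S" "f ` S \<subseteq> T"
  shows "C_k k g T \<Longrightarrow> C_k k f S \<Longrightarrow> C_k k (\<lambda>x. g (f x)) S"
proof (induction k arbitrary: g)
  case 0
  then show ?case using assms by (auto intro: continuous_on_compose2)
next
  case (Suc k)
  let ?f = "\<lambda>x. frechet_derivative f (at x)" and ?g = "\<lambda>x. frechet_derivative g (at x)"
  show ?case
  proof (rule C_k_SucI[OF assms(1), where f' = "\<lambda>x v. \<Sum>j\<in>Basis. (?f x v \<bullet> j) *\<^sub>R ?g (f x) j"])
    fix x assume x: "x \<in> S"
    have g: "(g has_derivative ?g (f x)) (at (f x))"
      using x assms(2) C_k_Suc_has_derivative[OF Suc.prems(1)] by blast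
    have "((\<lambda>x. g (f x)) has_derivative (\<lambda>v. ?g (f x) (?f x v))) (at x)"
      using diff_chain_at[OF C_k_Suc_has_derivative[OF Suc.prems(2) x] g] by (simp add: o_def)
    then show "((\<lambda>x. g (f x)) has_derivative (\<lambda>v. \<Sum>j\<in>Basis. (?f x v \<bullet> j) *\<^sub>R ?g (f x) j)) (at x)"
      unfolding linear_Basis_expansion[OF has_derivative_linear[OF g], of "?f x _"] .
  next
    fix v
    show "C_k k (\<lambda>x. \<Sum>j\<in>Basis. (?f x v \<bullet> j) *\<^sub>R ?g (f x) j) S"
    proof (intro C_k_sum C_k_scaleR assms(1))
      fix j :: 'b
      show "C_k k (\<lambda>x. ?f x v \<bullet> j) S"
        using Suc.prems(2) by (intro C_k_bounded_linear[OF assms(1) bounded_linear_inner_left]) auto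
      show "C_k k (\<lambda>x. ?g (f x) j) S"
        using Suc.prems(1) C_k_Suc_imp_C_k[OF Suc.prems(2)] by (intro Suc.IH) auto
    qed
  qed
qed

text \<open>Both mixed derivatives are limits of the same second difference quotient.\<close>

lemma frechet_derivative_commute_real:
  fixes F :: "'a::real_normed_vector \<Rightarrow> real"
  assumes "open S" "x \<in> S" "C_k 2 F S"
  defines "D \<equiv> \<lambda>u x. frechet_derivative F (at x) u"
  shows "frechet_derivative (D u) (at x) v = frechet_derivative (D v) (at x) u"
proof (rule ccontr)
  define D2 where "D2 u v x = frechet_derivative (D u) (at x) v" for u v x
  have C: "C_k (Suc 0) (D u) S" for u
    using assms(3) unfolding D_def numeral_2_eq_2 by (metis C_k.simps(2))
  have dF: "(F has_derivative (\<lambda>u. D u y)) (at y)" if "y \<in> S" for y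
    using C_k_Suc_has_derivative[of "Suc 0" F S y] assms(3) that unfolding D_def numeral_2_eq_2 by blast
  have dD: "(D u has_derivative (\<lambda>v. D2 u v y)) (at y)" if "y \<in> S" for y u
    using C_k_Suc_has_derivative[OF C that, of u] unfolding D2_def .
  have cont: "continuous_on S (D2 u v)" for u v
    using C[of u] unfolding D2_def by simp
  assume "\<not> ?thesis"
  then have ne: "D2 u v x \<noteq> D2 v u x" unfolding D2_def .
  \<comment> \<open>Half of the gap: values closer than \<open>e\<close> to the two different
    derivatives cannot coincide.\<close>
  define e where "e = \<bar>D2 u v x - D2 v u x\<bar> / 2"
  have e: "e > 0" using ne by (simp add: e_def)
  have "\<exists>d>0. \<forall>y. dist y x < d \<longrightarrow> y \<in> S \<and> dist (D2 u v y) (D2 u v x) < e" for u v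
  proof -
    have "(D2 u v \<longlongrightarrow> D2 u v x) (at x)"
      using cont assms(1,2) continuous_on_eq_continuous_at isCont_def by blast
    then obtain d1 where "d1 > 0" "\<And>y. dist y x < d1 \<Longrightarrow> dist (D2 u v y) (D2 u v x) < e"
      using e unfolding LIM_def by (metis dist_self)
    moreover obtain d2 where "d2 > 0" "\<And>y. dist y x < d2 \<Longrightarrow> y \<in> S"
      using assms(1,2) open_dist by blast
    ultimately show ?thesis by (intro exI[of _ "min d1 d2"]) auto
  qed
  then obtain d1 d2 where d: "d1 > 0" "d2 > 0"
      "\<And>y. dist y x < d1 \<Longrightarrow> y \<in> S \<and> dist (D2 u v y) (D2 u v x) < e"
      "\<And>y. dist y x < d2 \<Longrightarrow> y \<in> S \<and> dist (D2 v u y) (D2 v u x) < e"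
    by meson
  \<comment> \<open>Keeps the whole parallelogram with sides \<open>t u\<close> and
    \<open>t v\<close> within half of the smaller radius; the summand 1 makes the denominator
    positive even for zero directions.\<close>
  define t where "t = min d1 d2 / (2 * (norm u + norm v + 1))"
  have n: "norm u + norm v + 1 > 0" by (simp add: add_nonneg_pos)
  have t: "t > 0" using d n by (simp add: t_def)
  have small: "dist (x + a *\<^sub>R u + b *\<^sub>R v) x < min d1 d2" if "0 \<le> a" "a \<le> t" "0 \<le> b" "b \<le> t" for a b
  proof -
    have "dist (x + a *\<^sub>R u + b *\<^sub>R v) x = norm (a *\<^sub>R u + b *\<^sub>R v)" by (simp add: dist_norm)
    also have "\<dots> \<le> norm (a *\<^sub>R u) + norm (b *\<^sub>R v)" by (rule norm_triangle_ineq)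
    also have "\<dots> \<le> t * norm u + t * norm v"
      using that by (intro add_mono) (auto intro!: mult_right_mono)
    also have "\<dots> < t * (norm u + norm v + 1)" using t by (simp add: algebra_simps)
    also have "\<dots> = min d1 d2 / 2" using n unfolding t_def by (simp add: field_simps)
    also have "\<dots> < min d1 d2" using d(1,2) by (auto simp: min_def)
    finally show ?thesis .
  qed
  have inS: "x + a *\<^sub>R u + b *\<^sub>R v \<in> S" if "0 \<le> a" "a \<le> t" "0 \<le> b" "b \<le> t" for a b
    using d(3) small[OF that] by simp
  \<comment> \<open>The mean value theorem is used twice, along \<open>u\<close> and then along
    \<open>v\<close>. The directions are quantified anew so that the fact also applies with their
    roles exchanged.\<close>
  have key: "\<exists>a b. 0 < a \<and> a < t \<and> 0 < b \<and> b < t \<and>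
      F (x + t *\<^sub>R u + t *\<^sub>R v) - F (x + t *\<^sub>R u) - (F (x + t *\<^sub>R v) - F x) = t * t * D2 u v (x + a *\<^sub>R u + b *\<^sub>R v)"
    if S: "\<And>a b. \<lbrakk>0 \<le> a; a \<le> t; 0 \<le> b; b \<le> t\<rbrakk> \<Longrightarrow> x + a *\<^sub>R u + b *\<^sub>R v \<in> S" for u v
  proof -
    have "((\<lambda>s. F (x + s *\<^sub>R u + c *\<^sub>R v)) has_real_derivative D u (x + s *\<^sub>R u + c *\<^sub>R v)) (at s)"
      if "0 \<le> s" "s \<le> t" "0 \<le> c" "c \<le> t" for s c
    proof -
      have "((\<lambda>s. x + s *\<^sub>R u + c *\<^sub>R v) has_derivative (\<lambda>r. r *\<^sub>R u)) (at s)"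
        by (auto intro!: derivative_eq_intros)
      from diff_chain_at[OF this dF[OF S[OF that]]]
      show ?thesis
        using linear_cmul[OF has_derivative_linear[OF dF[OF S[OF that]]]]
        by (simp add: o_def has_field_derivative_def mult_commute_abs)
    qed
    from DERIV_diff[OF this[where c=t] this[where c=0]] t
    have "((\<lambda>s. F (x + s *\<^sub>R u + t *\<^sub>R v) - F (x + s *\<^sub>R u)) has_real_derivative
          D u (x + s *\<^sub>R u + t *\<^sub>R v) - D u (x + s *\<^sub>R u)) (at s)" if "0 \<le> s" "s \<le> t" for s
      using that by simp
    from MVT2[OF t this] obtain a where a: "0 < a" "a < t"
      "F (x + t *\<^sub>R u + t *\<^sub>R v) - F (x + t *\<^sub>R u) - (F (x + t *\<^sub>R v) - F x)
        = t * (D u (x + a *\<^sub>R u + t *\<^sub>R v) - D u (x + a *\<^sub>R u))"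
      by auto
    have "((\<lambda>s. D u (x + a *\<^sub>R u + s *\<^sub>R v)) has_real_derivative D2 u v (x + a *\<^sub>R u + s *\<^sub>R v)) (at s)"
      if "0 \<le> s" "s \<le> t" for s
    proof -
      have S': "x + a *\<^sub>R u + s *\<^sub>R v \<in> S" using S a that by auto
      have "((\<lambda>s. x + a *\<^sub>R u + s *\<^sub>R v) has_derivative (\<lambda>r. r *\<^sub>R v)) (at s)"
        by (auto intro!: derivative_eq_intros)
      from diff_chain_at[OF this dD[OF S']]
      show ?thesis
        using linear_cmul[OF has_derivative_linear[OF dD[OF S']]]
        by (simp add: o_def has_field_derivative_def mult_commute_abs)
    qed
    from MVT2[OF t this] obtain b where b: "0 < b" "b < t"
      "D u (x + a *\<^sub>R u + t *\<^sub>R v) - D u (x + a *\<^sub>R u) = t * D2 u v (x + a *\<^sub>R u + b *\<^sub>R v)"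
      by auto
    show ?thesis using a b by (metis mult.assoc)
  qed
  obtain a b where ab: "0 < a" "a < t" "0 < b" "b < t"
      "F (x + t *\<^sub>R u + t *\<^sub>R v) - F (x + t *\<^sub>R u) - (F (x + t *\<^sub>R v) - F x) = t * t * D2 u v (x + a *\<^sub>R u + b *\<^sub>R v)"
    using key[of u v] inS by blast
  obtain a' b' where ab': "0 < a'" "a' < t" "0 < b'" "b' < t"
      "F (x + t *\<^sub>R v + t *\<^sub>R u) - F (x + t *\<^sub>R v) - (F (x + t *\<^sub>R u) - F x) = t * t * D2 v u (x + a' *\<^sub>R v + b' *\<^sub>R u)"
    using key[of v u] inS by (auto simp: add.assoc add.commute[of "_ *\<^sub>R v"])
  have sw: "x + t *\<^sub>R v + t *\<^sub>R u = x + t *\<^sub>R u + t *\<^sub>R v" "x + a' *\<^sub>R v + b' *\<^sub>R u = x + b' *\<^sub>R u + a' *\<^sub>R v"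
    by simp_all
  have "t * t * D2 u v (x + a *\<^sub>R u + b *\<^sub>R v) = t * t * D2 v u (x + b' *\<^sub>R u + a' *\<^sub>R v)"
    using ab(5) ab'(5) unfolding sw by linarith
  then have "D2 u v (x + a *\<^sub>R u + b *\<^sub>R v) = D2 v u (x + b' *\<^sub>R u + a' *\<^sub>R v)" using t by simp
  moreover have "dist (D2 u v (x + a *\<^sub>R u + b *\<^sub>R v)) (D2 u v x) < e"
    using d(3) small[of a b] ab by auto
  moreover have "dist (D2 v u (x + b' *\<^sub>R u + a' *\<^sub>R v)) (D2 v u x) < e"
    using d(4) small[of b' a'] ab' by auto
  ultimately have "\<bar>D2 u v x - D2 v u x\<bar> < 2 * e" unfolding dist_real_def by linarith
  then show False by (simp add: e_def)
qed

text \<open>Taken component by component, because the mean value theorem behind the real case fails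
  for vector values.\<close>

lemma frechet_derivative_commute:
  fixes F :: "'a::real_normed_vector \<Rightarrow> 'b::euclidean_space"
  assumes "open S" "x \<in> S" "C_k 2 F S"
  shows "frechet_derivative (\<lambda>x. frechet_derivative F (at x) u) (at x) v
       = frechet_derivative (\<lambda>x. frechet_derivative F (at x) v) (at x) u"
proof (rule euclidean_eqI)
  fix i :: 'b assume "i \<in> Basis"
  let ?Fi = "\<lambda>x. F x \<bullet> i"
  have dF: "(F has_derivative frechet_derivative F (at y)) (at y)" if "y \<in> S" for y
    using assms(3) that C_k_Suc_has_derivative unfolding numeral_2_eq_2 by blast
  have "C_k 2 ?Fi S" by (rule C_k_bounded_linear[OF assms(1) bounded_linear_inner_left assms(3)])
  note comm = frechet_derivative_commute_real[OF assms(1,2) this, of u v]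
  have 1: "frechet_derivative ?Fi (at y) w = frechet_derivative F (at y) w \<bullet> i" if "y \<in> S" for y w
    by (metis dF[OF that] frechet_derivative_at has_derivative_inner_left)
  have 2: "frechet_derivative (\<lambda>x. frechet_derivative ?Fi (at x) w) (at x) w'
      = frechet_derivative (\<lambda>x. frechet_derivative F (at x) w) (at x) w' \<bullet> i" for w w'
  proof -
    have "((\<lambda>x. frechet_derivative F (at x) w) has_derivative
        frechet_derivative (\<lambda>x. frechet_derivative F (at x) w) (at x)) (at x)"
      using assms(2,3) C_k_Suc_has_derivative unfolding numeral_2_eq_2 by (metis C_k.simps(2))
    from has_derivative_inner_left[OF this, of i]
    have "((\<lambda>x. frechet_derivative ?Fi (at x) w) has_derivative
        (\<lambda>w'. frechet_derivative (\<lambda>x. frechet_derivative F (at x) w) (at x) w' \<bullet> i)) (at x)"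
      by (rule has_derivative_transform_within_open[OF _ assms(1,2)]) (simp add: 1)
    then show ?thesis by (metis frechet_derivative_at)
  qed
  show "frechet_derivative (\<lambda>x. frechet_derivative F (at x) u) (at x) v \<bullet> i
       = frechet_derivative (\<lambda>x. frechet_derivative F (at x) v) (at x) u \<bullet> i"
    using comm unfolding 2 .
qed

text \<open>The coefficients \<open>z\<close> need not be differentiable: a continuous lower bound for \<open>J\<close> makes
  \<open>z x - z x0\<close> of the order of \<open>x - x0\<close>, so that \<open>(J x - J x0) (z x - z x0)\<close> does not contribute
  to the derivative.\<close>

lemma tangential_derivative:
  fixes J :: "'a::real_normed_vector \<Rightarrow> 'd::euclidean_space \<Rightarrow> 'e::euclidean_space"
  assumes S: "open S" "x0 \<in> S"
    and lin: "\<And>x. x \<in> S \<Longrightarrow> linear (J x)" and inj: "inj (J x0)"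
    and cont: "\<And>v. isCont (\<lambda>x. J x v) x0"
    and V: "\<And>x. x \<in> S \<Longrightarrow> V x = J x (z x)"
    and dV: "(V has_derivative V') (at x0)"
    and dJ: "((\<lambda>x. J x (z x0)) has_derivative J') (at x0)"
  shows "V' u - J' u \<in> range (J x0)"
proof -
  \<comment> \<open>\<open>V\<close> minus the field whose coefficients are frozen at
    \<open>x0\<close>. It vanishes at \<open>x0\<close>, and its derivative in direction
    \<open>u\<close> is the vector \<open>w\<close> that has to be placed in the range.\<close>
  define R where "R x = V x - J x (z x0)" for x
  define w where "w = V' u - J' u"
  \<comment> \<open>Continuity of \<open>J\<close> is assumed in fixed directions only; the sum over
    the basis turns it into one bound for all directions that tends to 0.\<close>
  define \<delta> where "\<delta> x = (\<Sum>i\<in>Basis. norm (J x i - J x0 i))" for x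
  have dR: "(R has_derivative (\<lambda>v. V' v - J' v)) (at x0)"
    unfolding R_def by (intro has_derivative_diff dV dJ)
  have R0: "R x0 = 0" using V[OF S(2)] by (simp add: R_def)
  have Req: "R x = J x (z x - z x0)" if "x \<in> S" for x
    using V[OF that] lin[OF that] by (simp add: R_def linear_diff)
  have J\<delta>: "norm (J x y - J x0 y) \<le> \<delta> x * norm y" if "x \<in> S" for x y
  proof -
    have "J x y - J x0 y = (\<Sum>i\<in>Basis. (y \<bullet> i) *\<^sub>R (J x i - J x0 i))"
      using linear_Basis_expansion[OF lin[OF that], of y] linear_Basis_expansion[OF lin[OF S(2)], of y]
      by (simp add: sum_subtractf scaleR_diff_right)
    also have "norm \<dots> \<le> (\<Sum>i\<in>Basis. \<bar>y \<bullet> i\<bar> * norm (J x i - J x0 i))"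
      by (rule order_trans[OF norm_sum]) simp
    also have "\<dots> \<le> (\<Sum>i\<in>Basis. norm y * norm (J x i - J x0 i))"
      by (intro sum_mono mult_right_mono) (auto simp: Basis_le_norm)
    finally show ?thesis by (simp add: \<delta>_def sum_distrib_left mult.commute)
  qed
  obtain m where m: "m > 0" "\<And>y. m * norm y \<le> norm (J x0 y)"
    using linear_inj_bounded_below_pos[OF lin[OF S(2)] inj] by blast
  define \<gamma> where "\<gamma> t = x0 + t *\<^sub>R u" for t :: real
  have d\<gamma>: "(\<gamma> has_derivative (\<lambda>t. t *\<^sub>R u)) (at 0)"
    unfolding \<gamma>_def by (auto intro!: derivative_eq_intros)
  have \<gamma>0: "\<gamma> 0 = x0" by (simp add: \<gamma>_def)
  have lim\<gamma>: "(\<gamma> \<longlongrightarrow> x0) (at 0)"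
    using has_derivative_continuous[OF d\<gamma>] by (simp add: isCont_def \<gamma>0)
  have "isCont \<delta> x0" unfolding \<delta>_def by (intro continuous_intros cont)
  then have "isCont (\<lambda>t. \<delta> (\<gamma> t)) 0"
    by (intro isCont_o2[OF has_derivative_continuous[OF d\<gamma>]]) (simp add: \<gamma>0)
  then have lim\<delta>: "((\<lambda>t. \<delta> (\<gamma> t)) \<longlongrightarrow> 0) (at 0)"
    by (simp add: isCont_def \<gamma>0) (simp add: \<delta>_def)
  have "((\<lambda>t. R (\<gamma> t)) has_derivative (\<lambda>t. t *\<^sub>R w)) (at 0)"
  proof -
    have "linear (\<lambda>v. V' v - J' v)" by (rule has_derivative_linear[OF dR])
    from linear_cmul[OF this, of _ u]
    show ?thesis
      using diff_chain_at[OF d\<gamma>, of R "\<lambda>v. V' v - J' v"] dR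
      by (simp add: o_def \<gamma>0 w_def)
  qed
  then have lim: "((\<lambda>t. norm (R (\<gamma> t) - t *\<^sub>R w) / norm t) \<longlongrightarrow> 0) (at 0)"
    by (simp add: has_derivative_at \<gamma>0 R0)
  have eq: "norm (R (\<gamma> t) - t *\<^sub>R w) / norm t = norm ((1/t) *\<^sub>R R (\<gamma> t) - w)" if "t \<noteq> 0" for t
  proof -
    have "(1/t) *\<^sub>R R (\<gamma> t) - w = (1/t) *\<^sub>R (R (\<gamma> t) - t *\<^sub>R w)"
      using that by (simp add: scaleR_diff_right)
    then show ?thesis by simp
  qed
  have "((\<lambda>t. norm ((1/t) *\<^sub>R R (\<gamma> t) - w)) \<longlongrightarrow> 0) (at 0)"
    by (rule Lim_transform_eventually[OF lim]) (use eq in \<open>auto simp: eventually_at_filter\<close>)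
  then have limR: "((\<lambda>t. (1/t) *\<^sub>R R (\<gamma> t)) \<longlongrightarrow> w) (at 0)"
    by (simp add: tendsto_norm_zero_iff LIM_zero_iff)
  \<comment> \<open>Testing against vectors orthogonal to the range is enough: applied to the
    orthogonal component of \<open>w\<close>, it makes that component vanish.\<close>
  have "\<mu> \<bullet> w = 0" if \<mu>: "\<And>y. \<mu> \<bullet> J x0 y = 0" for \<mu>
  proof -
    have bound: "\<forall>\<^sub>F t in at 0. norm (\<mu> \<bullet> ((1/t) *\<^sub>R R (\<gamma> t))) \<le> norm \<mu> * (2 / m) * \<delta> (\<gamma> t) * norm ((1/t) *\<^sub>R R (\<gamma> t))"
    proof -
      have "\<forall>\<^sub>F t in at 0. \<gamma> t \<in> S" using lim\<gamma> S topological_tendstoD by blast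
      \<comment> \<open>While \<open>\<delta>\<close> stays below \<open>m / 2\<close>, half of the
        lower bound for \<open>J x0\<close> survives for \<open>J (\<gamma> t)\<close>, which gives
        the factor \<open>2 / m\<close> in the estimate of \<open>y\<close>.\<close>
      moreover have "\<forall>\<^sub>F t in at 0. \<delta> (\<gamma> t) < m / 2" using lim\<delta> m(1) by (intro order_tendstoD) auto
      ultimately show ?thesis
      proof eventually_elim
        case (elim t)
        define y where "y = z (\<gamma> t) - z x0"
        have R: "R (\<gamma> t) = J (\<gamma> t) y" using Req elim y_def by blast
        have "m * norm y \<le> norm (J x0 y)" by (rule m)
        also have "\<dots> \<le> norm (J (\<gamma> t) y) + norm (J (\<gamma> t) y - J x0 y)"
          using norm_triangle_sub[of "J x0 y" "J (\<gamma> t) y"] by (simp add: norm_minus_commute)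
        also have "\<dots> \<le> norm (R (\<gamma> t)) + (m / 2) * norm y"
          using J\<delta>[OF elim(1), of y] mult_right_mono[of "\<delta> (\<gamma> t)" "m/2" "norm y"] elim(2)
          unfolding R by auto
        finally have y: "norm y \<le> (2 / m) * norm (R (\<gamma> t))" using m(1) by (simp add: field_simps)
        have d0: "\<delta> (\<gamma> t) \<ge> 0" unfolding \<delta>_def by (intro sum_nonneg) auto
        \<comment> \<open>Since \<open>\<mu>\<close> annihilates the values of \<open>J x0\<close>,
          only the difference of \<open>J (\<gamma> t)\<close> and \<open>J x0\<close> contributes.
          This produces the factor \<open>\<delta>\<close>, which tends to 0 while the quotient of
          \<open>R\<close> by \<open>t\<close> converges.\<close>
        have "norm (\<mu> \<bullet> R (\<gamma> t)) = norm (\<mu> \<bullet> (J (\<gamma> t) y - J x0 y))"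
          unfolding R by (simp add: inner_diff_right \<mu>)
        also have "\<dots> \<le> norm \<mu> * norm (J (\<gamma> t) y - J x0 y)" by (simp add: Cauchy_Schwarz_ineq2)
        also have "\<dots> \<le> norm \<mu> * (\<delta> (\<gamma> t) * ((2 / m) * norm (R (\<gamma> t))))"
          by (intro mult_left_mono order_trans[OF J\<delta>[OF elim(1)]] y d0) auto
        finally have "norm (\<mu> \<bullet> R (\<gamma> t)) \<le> norm \<mu> * (2 / m) * \<delta> (\<gamma> t) * norm (R (\<gamma> t))"
          by (simp add: mult_ac)
        from mult_left_mono[OF this, of "\<bar>1/t\<bar>"] show ?case
          by (simp add: abs_mult mult_ac)
      qed
    qed
    have "((\<lambda>t. norm \<mu> * (2 / m) * \<delta> (\<gamma> t) * norm ((1/t) *\<^sub>R R (\<gamma> t))) \<longlongrightarrow> norm \<mu> * (2 / m) * 0 * norm w) (at 0)"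
      by (intro tendsto_intros lim\<delta> limR)
    then have "((\<lambda>t. \<mu> \<bullet> ((1/t) *\<^sub>R R (\<gamma> t))) \<longlongrightarrow> 0) (at 0)"
      by (intro Lim_null_comparison[OF bound]) simp
    moreover have "((\<lambda>t. \<mu> \<bullet> ((1/t) *\<^sub>R R (\<gamma> t))) \<longlongrightarrow> \<mu> \<bullet> w) (at 0)"
      by (intro tendsto_intros limR)
    ultimately show ?thesis by (metis LIM_unique)
  qed
  moreover have sub: "subspace (range (J x0))"
    by (rule linear_subspace_image[OF lin[OF S(2)]]) simp
  moreover obtain a n where "a \<in> range (J x0)" "\<And>y. y \<in> range (J x0) \<Longrightarrow> orthogonal n y" "w = a + n"
    using orthogonal_subspace_decomp_exists[of "range (J x0)" w] sub span_eq_iff by metis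
  ultimately have "n \<bullet> w = 0" "n \<bullet> a = 0" "w = a + n" "a \<in> range (J x0)"
    by (auto simp: orthogonal_def)
  then have "n = 0" by (simp add: inner_add_right)
  then show ?thesis using \<open>w = a + n\<close> \<open>a \<in> _\<close> w_def by simp
qed

section \<open>Charts and tangent vectors\<close>

lemma chart_inv_chart_map: "is_chart c \<Longrightarrow> q \<in> chart_dom c \<Longrightarrow> chart_inv c (chart_map c q) = q"
  by (auto simp: is_chart_def homeomorphism_def)

lemma open_chart_image:
  assumes "is_chart c" "open U" shows "open (chart_map c ` (chart_dom c \<inter> U))"
proof -
  have "chart_map c ` (chart_dom c \<inter> U) = chart_map c ` chart_dom c \<inter> chart_inv c -` U"
    using chart_inv_chart_map[OF assms(1)] by force
  moreover have "continuous_on (chart_map c ` chart_dom c) (chart_inv c)" "open (chart_map c ` chart_dom c)"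
    using assms(1) by (auto simp: is_chart_def homeomorphism_def)
  ultimately show ?thesis
    using assms(2) by (metis Int_commute continuous_on_open_vimage)
qed

lemma has_derivative_frechet:
  assumes "(f has_derivative f') (at x)"
  shows "frechet_derivative f (at x) = f'" "f differentiable at x"
  using assms frechet_derivative_at by (auto simp: differentiable_def)

lemma smooth_on_C_k_derivative: "smooth_on S f \<Longrightarrow> C_k k (\<lambda>x. frechet_derivative f (at x) v) S"
  unfolding smooth_on_def using C_k.simps(2) by blast

lemma smooth_on_has_derivative:
  assumes "smooth_on S f" "x \<in> S"
  shows "(f has_derivative frechet_derivative f (at x)) (at x)"
  using assms C_k_Suc_has_derivative unfolding smooth_on_def by blast

lemma smooth_on_subset: "smooth_on S f \<Longrightarrow> T \<subseteq> S \<Longrightarrow> smooth_on T f"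
  unfolding smooth_on_def using C_k_subset by blast

lemma smooth_on_cong: "open S \<Longrightarrow> (\<And>x. x \<in> S \<Longrightarrow> f x = g x) \<Longrightarrow> smooth_on S f \<Longrightarrow> smooth_on S g"
  unfolding smooth_on_def using C_k_cong by blast

lemma sum_fun_component: "(\<Sum>i\<in>I. Y i) c = (\<Sum>i\<in>I. Y i c)"
  by (induction I rule: infinite_finite_induct) auto

locale atlas =
  fixes A :: "('m::{t2_space,second_countable_topology}, 'e::euclidean_space) chart set"
  assumes manifold: "smooth_manifold A"
begin

lemma is_chart: "c \<in> A \<Longrightarrow> is_chart c"
  using manifold by (auto simp: smooth_manifold_def)

lemma chart_inv_map [simp]: "c \<in> charts_at A q \<Longrightarrow> chart_inv c (chart_map c q) = q"
  by (auto simp: charts_at_def intro: chart_inv_chart_map is_chart)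

lemma chart_at_mem: "chart_at A q \<in> charts_at A q"
proof -
  have "q \<in> (\<Union>c\<in>A. chart_dom c)" using manifold by (simp add: smooth_manifold_def)
  then have "\<exists>c. c \<in> charts_at A q" by (auto simp: charts_at_def)
  then show ?thesis unfolding chart_at_def by (rule someI_ex)
qed

lemma open_dom: "c \<in> A \<Longrightarrow> open (chart_dom c)"
  using is_chart by (auto simp: is_chart_def)

lemma smooth_transition:
  "c \<in> A \<Longrightarrow> c' \<in> A \<Longrightarrow> smooth_on (chart_map c ` (chart_dom c \<inter> chart_dom c')) (chart_map c' \<circ> chart_inv c)"
  using manifold by (auto simp: smooth_manifold_def)

lemma has_derivative_transition:
  assumes "c \<in> charts_at A q" "c' \<in> charts_at A q"
  shows "(chart_map c' \<circ> chart_inv c has_derivative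
           frechet_derivative (chart_map c' \<circ> chart_inv c) (at (chart_map c q))) (at (chart_map c q))"
  using assms by (intro smooth_on_has_derivative[OF smooth_transition]) (auto simp: charts_at_def)

text \<open>The chain rule on the overlap of two charts. With a chart map as \<open>h\<close> it
  yields the cocycle rule, with a real function the invariance of directional derivatives, and with
  \<open>chart_map c \<circ> f\<close> a change of the source chart of an immersion.\<close>

lemma has_derivative_change_chart:
  fixes h :: "'m \<Rightarrow> 'z::real_normed_vector"
  assumes c: "c \<in> charts_at A q" and c': "c' \<in> charts_at A q"
    and h: "(h \<circ> chart_inv c has_derivative h') (at (chart_map c q))"
  shows "(h \<circ> chart_inv c' has_derivative
      (\<lambda>v. h' (frechet_derivative (chart_map c \<circ> chart_inv c') (at (chart_map c' q)) v))) (at (chart_map c' q))"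
proof -
  let ?S = "chart_map c' ` (chart_dom c' \<inter> chart_dom c)"
  have S: "open ?S" "chart_map c' q \<in> ?S"
    using c c' open_dom is_chart by (auto simp: charts_at_def intro!: open_chart_image)
  have h2: "(h \<circ> chart_inv c has_derivative h') (at ((chart_map c \<circ> chart_inv c') (chart_map c' q)))"
    using h c' by simp
  have "((h \<circ> chart_inv c) \<circ> (chart_map c \<circ> chart_inv c') has_derivative
      h' \<circ> frechet_derivative (chart_map c \<circ> chart_inv c') (at (chart_map c' q))) (at (chart_map c' q))"
    by (rule diff_chain_at[OF has_derivative_transition[OF c' c] h2])
  then have "((h \<circ> chart_inv c) \<circ> (chart_map c \<circ> chart_inv c') has_derivative
      (\<lambda>v. h' (frechet_derivative (chart_map c \<circ> chart_inv c') (at (chart_map c' q)) v))) (at (chart_map c' q))"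
    by (simp add: o_def)
  then show ?thesis
  proof (rule has_derivative_transform_within_open[OF _ S])
    fix x assume "x \<in> ?S"
    then obtain r where "x = chart_map c' r" "r \<in> chart_dom c'" "r \<in> chart_dom c" by auto
    then show "((h \<circ> chart_inv c) \<circ> (chart_map c \<circ> chart_inv c')) x = (h \<circ> chart_inv c') x"
      using c c' by (auto simp: charts_at_def chart_inv_chart_map is_chart)
  qed
qed

lemma frechet_derivative_self:
  assumes "c \<in> charts_at A q"
  shows "frechet_derivative (chart_map c \<circ> chart_inv c) (at (chart_map c q)) = (\<lambda>v. v)"
proof -
  let ?S = "chart_map c ` (chart_dom c \<inter> UNIV)"
  have S: "open ?S" "chart_map c q \<in> ?S"
    using assms is_chart by (auto simp: charts_at_def intro!: open_chart_image[where U=UNIV, simplified])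
  have "(chart_map c \<circ> chart_inv c has_derivative (\<lambda>v. v)) (at (chart_map c q))"
    by (rule has_derivative_transform_within_open[OF has_derivative_ident S])
      (use assms in \<open>auto simp: charts_at_def chart_inv_chart_map is_chart\<close>)
  then show ?thesis by (rule has_derivative_frechet)
qed

lemma transition_compose:
  assumes "c \<in> charts_at A q" "c' \<in> charts_at A q" "c'' \<in> charts_at A q"
  shows "frechet_derivative (chart_map c'' \<circ> chart_inv c') (at (chart_map c' q))
           (frechet_derivative (chart_map c' \<circ> chart_inv c) (at (chart_map c q)) x)
       = frechet_derivative (chart_map c'' \<circ> chart_inv c) (at (chart_map c q)) x"
  using has_derivative_frechet(1)[OF has_derivative_change_chart[OF assms(2,1) has_derivative_transition[OF assms(2,3)]]]
  by simp

lemma linear_transition: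
  assumes "c \<in> charts_at A q" "c' \<in> charts_at A q"
  shows "linear (frechet_derivative (chart_map c' \<circ> chart_inv c) (at (chart_map c q)))"
  using has_derivative_transition[OF assms] by (rule has_derivative_linear)

section \<open>Tangent vectors and their components in a chart\<close>

lemma tangent_vector_mem: "c \<in> charts_at A q \<Longrightarrow> tangent_vector A c q x \<in> tangent_space A q"
  unfolding tangent_space_def tangent_vector_def by (auto simp: transition_compose)

lemma tangent_vector_component [simp]: "c \<in> charts_at A q \<Longrightarrow> tangent_vector A c q x c = x"
  by (simp add: tangent_vector_def frechet_derivative_self)

lemma tangent_space_component:
  "v \<in> tangent_space A q \<Longrightarrow> c \<in> charts_at A q \<Longrightarrow> c' \<in> charts_at A q \<Longrightarrow>
    v c' = frechet_derivative (chart_map c' \<circ> chart_inv c) (at (chart_map c q)) (v c)"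
  unfolding tangent_space_def by blast

text \<open>One component determines the others through the coordinate changes, and the default
  value 0 settles the arguments that are not charts around \<open>q\<close>.\<close>

lemma tangent_vector_of_component:
  assumes c: "c \<in> charts_at A q" and v: "v \<in> tangent_space A q"
  shows "tangent_vector A c q (v c) = v"
proof
  fix c'
  have "c' \<notin> charts_at A q \<Longrightarrow> v c' = 0" using v unfolding tangent_space_def by blast
  then show "tangent_vector A c q (v c) c' = v c'"
    using tangent_space_component[OF v c] by (cases "c' \<in> charts_at A q") (simp_all add: tangent_vector_def)
qed

lemma tangent_vector_linear: 
  assumes "c \<in> charts_at A q" shows "linear (tangent_vector A c q)"
proof (rule linearI)
  show "tangent_vector A c q (x + y) = tangent_vector A c q x + tangent_vector A c q y" for x y
    using linear_transition[OF assms] by (auto simp: tangent_vector_def fun_eq_iff linear_add)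
  show "tangent_vector A c q (r *\<^sub>R x) = r *\<^sub>R tangent_vector A c q x" for r x
    using linear_transition[OF assms] by (auto simp: tangent_vector_def fun_eq_iff linear_cmul scaleR_fun_def)
qed

lemma subspace_tangent_space: "subspace (tangent_space A q)"
proof -
  have "tangent_space A q = range (tangent_vector A (chart_at A q) q)"
    using tangent_vector_of_component[OF chart_at_mem] tangent_vector_mem[OF chart_at_mem] by (metis (no_types, lifting) image_subsetI rangeI subsetI subset_antisym)
  then show ?thesis
    using linear_subspace_image[OF tangent_vector_linear[OF chart_at_mem]] by simp
qed

text \<open>Frees the derivative from the chart that \<open>chart_at\<close> happens to
  pick.\<close>

lemma directional_derivative_eq:
  assumes "c \<in> charts_at A p" "v \<in> tangent_space A p"
    and h: "(h \<circ> chart_inv c has_derivative h') (at (chart_map c p))"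
  shows "directional_derivative A p v h = h' (v c)"
  using has_derivative_frechet(1)[OF has_derivative_change_chart[OF assms(1) chart_at_mem h]]
    tangent_space_component[OF assms(2) chart_at_mem assms(1)]
  by (simp add: directional_derivative_def Let_def)

section \<open>Vector fields in a chart\<close>

lemma charts_atI: "c \<in> A \<Longrightarrow> q \<in> chart_dom c \<Longrightarrow> c \<in> charts_at A q"
  by (simp add: charts_at_def)

lemma open_chart_image': "c \<in> A \<Longrightarrow> open U \<Longrightarrow> open (chart_map c ` (chart_dom c \<inter> U))"
  by (rule open_chart_image[OF is_chart])

text \<open>In another chart the components are the derivative of the transition map in the fixed
  direction \<open>x\<close>, evaluated after the inverse transition; both are smooth.\<close>

lemma vector_field_coordinate:
  assumes c: "c \<in> A" shows "vector_field A (chart_dom c) (\<lambda>q. tangent_vector A c q x)"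
  unfolding vector_field_def
proof (intro conjI ballI)
  fix q assume "q \<in> chart_dom c"
  then show "tangent_vector A c q x \<in> tangent_space A q"
    using c by (intro tangent_vector_mem charts_atI)
next
  fix c' assume c': "c' \<in> A"
  let ?S = "chart_map c' ` (chart_dom c' \<inter> chart_dom c)" and ?T = "chart_map c ` (chart_dom c \<inter> chart_dom c')"
  let ?D = "\<lambda>y. frechet_derivative (chart_map c' \<circ> chart_inv c) (at y) x"
  have S: "open ?S" by (intro open_chart_image' c' open_dom c)
  have im: "(chart_map c \<circ> chart_inv c') ` ?S \<subseteq> ?T"
    using c' by (auto simp: chart_inv_chart_map is_chart)
  have "C_k k (\<lambda>y. ?D ((chart_map c \<circ> chart_inv c') y)) ?S" for k
    by (rule C_k_compose[OF S im smooth_on_C_k_derivative[OF smooth_transition[OF c c']]])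
      (use smooth_transition[OF c' c] in \<open>simp add: smooth_on_def\<close>)
  then have "smooth_on ?S (\<lambda>y. ?D ((chart_map c \<circ> chart_inv c') y))" by (simp add: smooth_on_def)
  then show "smooth_on ?S (\<lambda>y. tangent_vector A c (chart_inv c' y) x c')"
  proof (rule smooth_on_cong[OF S, rotated])
    fix y assume "y \<in> ?S"
    then show "?D ((chart_map c \<circ> chart_inv c') y) = tangent_vector A c (chart_inv c' y) x c'"
      using c c' by (auto simp: tangent_vector_def chart_inv_chart_map is_chart charts_at_def)
  qed
qed

text \<open>Smoothness of a field concerns each chart and the components in that same chart.
  Components in \<open>c\<close> viewed from \<open>c'\<close> mix the two, so they are rewritten
  through the derivative of the transition. They serve as coefficients in the Leibniz rule.\<close>

lemma smooth_fun_component: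
  assumes Y: "vector_field A U Y" and U: "open U" "U \<subseteq> chart_dom c" and c: "c \<in> A"
  shows "smooth_fun A U (\<lambda>q. Y q c \<bullet> i)"
  unfolding smooth_fun_def
proof
  fix c' assume c': "c' \<in> A"
  let ?S = "chart_map c' ` (chart_dom c' \<inter> U)"
  let ?D = "\<lambda>y. frechet_derivative (chart_map c \<circ> chart_inv c') (at y)"
  have S: "open ?S" by (intro open_chart_image' c' U)
  have "C_k k (\<lambda>y. \<Sum>j\<in>Basis. (Y (chart_inv c' y) c' \<bullet> j) *\<^sub>R (?D y j \<bullet> i)) ?S" for k
  proof (intro C_k_sum C_k_scaleR S C_k_bounded_linear[OF S bounded_linear_inner_left])
    fix j :: 'e
    show "C_k k (\<lambda>y. Y (chart_inv c' y) c') ?S"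
      using Y c' by (auto simp: vector_field_def smooth_on_def)
    show "C_k k (\<lambda>y. ?D y j) ?S"
      by (rule C_k_subset[OF _ smooth_on_C_k_derivative[OF smooth_transition[OF c' c]]]) (use U in auto)
  qed
  then have "smooth_on ?S (\<lambda>y. \<Sum>j\<in>Basis. (Y (chart_inv c' y) c' \<bullet> j) *\<^sub>R (?D y j \<bullet> i))"
    by (simp add: smooth_on_def)
  then show "smooth_on ?S ((\<lambda>q. Y q c \<bullet> i) \<circ> chart_inv c')"
  proof (rule smooth_on_cong[OF S, rotated])
    fix y assume "y \<in> ?S"
    then obtain q where q: "y = chart_map c' q" "q \<in> chart_dom c'" "q \<in> U" by auto
    then have ch: "c \<in> charts_at A q" "c' \<in> charts_at A q" using c c' U by (auto simp: charts_at_def)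
    have "Y q c = ?D y (Y q c')"
      using Y q ch by (auto simp: vector_field_def intro!: tangent_space_component)
    also have "\<dots> = (\<Sum>j\<in>Basis. (Y q c' \<bullet> j) *\<^sub>R ?D y j)"
      unfolding q by (rule linear_Basis_expansion[OF linear_transition[OF ch(2,1)]])
    finally show "(\<Sum>j\<in>Basis. (Y (chart_inv c' y) c' \<bullet> j) *\<^sub>R (?D y j \<bullet> i)) = ((\<lambda>q. Y q c \<bullet> i) \<circ> chart_inv c') y"
      using q ch by (simp add: inner_sum_left)
  qed
qed

lemma vector_field_has_derivative:
  assumes "vector_field A U Y" "c \<in> charts_at A q" "q \<in> U"
  shows "((\<lambda>y. Y (chart_inv c y) c) has_derivative
    frechet_derivative (\<lambda>y. Y (chart_inv c y) c) (at (chart_map c q))) (at (chart_map c q))"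
proof -
  have "smooth_on (chart_map c ` (chart_dom c \<inter> U)) (\<lambda>y. Y (chart_inv c y) c)"
    using assms by (auto simp: vector_field_def charts_at_def)
  from smooth_on_has_derivative[OF this, of "chart_map c q"] assms show ?thesis
    by (auto simp: charts_at_def)
qed

lemma vector_field_subset: "vector_field A U Y \<Longrightarrow> V \<subseteq> U \<Longrightarrow> vector_field A V Y"
  unfolding vector_field_def
  using smooth_on_subset[OF _ image_mono[OF Int_mono[OF subset_refl]]] by blast

lemma vector_field_scale:
  assumes U: "open U" and h: "smooth_fun A U h" and Y: "vector_field A U Y"
  shows "vector_field A U (\<lambda>q. h q *\<^sub>R Y q)"
  unfolding vector_field_def smooth_on_def
proof (intro conjI ballI allI)
  fix q assume "q \<in> U"
  then show "h q *\<^sub>R Y q \<in> tangent_space A q"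
    using Y unfolding vector_field_def by (blast intro: subspace_scale[OF subspace_tangent_space])
next
  fix c k assume c: "c \<in> A"
  have "C_k k (\<lambda>y. h (chart_inv c y)) (chart_map c ` (chart_dom c \<inter> U))"
    using h c unfolding smooth_fun_def smooth_on_def o_def by blast
  moreover have "C_k k (\<lambda>y. Y (chart_inv c y) c) (chart_map c ` (chart_dom c \<inter> U))"
    using Y c unfolding vector_field_def smooth_on_def by blast
  ultimately show "C_k k (\<lambda>y. (h (chart_inv c y) *\<^sub>R Y (chart_inv c y)) c) (chart_map c ` (chart_dom c \<inter> U))"
    unfolding scaleR_fun_def by (rule C_k_scaleR[OF open_chart_image'[OF c U]])
qed

lemma vector_field_sum:
  assumes U: "open U" and Y: "\<And>i. i \<in> I \<Longrightarrow> vector_field A U (Y i)"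
  shows "vector_field A U (\<lambda>q. \<Sum>i\<in>I. Y i q)"
  unfolding vector_field_def smooth_on_def
proof (intro conjI ballI allI)
  fix q assume "q \<in> U"
  then have "Y i q \<in> tangent_space A q" if "i \<in> I" for i
    using Y[OF that] unfolding vector_field_def by blast
  then show "(\<Sum>i\<in>I. Y i q) \<in> tangent_space A q"
    by (rule subspace_sum[OF subspace_tangent_space])
next
  fix c k assume c: "c \<in> A"
  have "C_k k (\<lambda>y. Y i (chart_inv c y) c) (chart_map c ` (chart_dom c \<inter> U))" if "i \<in> I" for i
    using Y[OF that] c unfolding vector_field_def smooth_on_def by blast
  then show "C_k k (\<lambda>y. (\<Sum>i\<in>I. Y i (chart_inv c y)) c) (chart_map c ` (chart_dom c \<inter> U))"
    unfolding sum_fun_component by (rule C_k_sum[OF open_chart_image'[OF c U]])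
qed

section \<open>Connections in a chart\<close>

lemma
  assumes nabla: "affine_connection A nabla" and U: "open U" "p \<in> U"
    and Y: "vector_field A U Y" and u: "u \<in> tangent_space A p"
  shows connection_mem: "nabla p u Y \<in> tangent_space A p"
    and connection_add: "vector_field A U Z \<Longrightarrow> nabla p u (\<lambda>q. Y q + Z q) = nabla p u Y + nabla p u Z"
    and connection_scale: "smooth_fun A U h \<Longrightarrow> nabla p u (\<lambda>q. h q *\<^sub>R Y q) =
      directional_derivative A p u h *\<^sub>R Y p + h p *\<^sub>R nabla p u Y"
proof -
  note conn = nabla[unfolded affine_connection_def, rule_format, OF U(1) Y]
  show "nabla p u Y \<in> tangent_space A p"
    by (rule conn[THEN conjunct1, rule_format, OF U(2) u])
  show "vector_field A U Z \<Longrightarrow> nabla p u (\<lambda>q. Y q + Z q) = nabla p u Y + nabla p u Z"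
    by (rule conn[THEN conjunct2, THEN conjunct2, THEN conjunct1, rule_format, OF _ U(2) u])
  show "smooth_fun A U h \<Longrightarrow> nabla p u (\<lambda>q. h q *\<^sub>R Y q) =
      directional_derivative A p u h *\<^sub>R Y p + h p *\<^sub>R nabla p u Y"
    by (rule conn[THEN conjunct2, THEN conjunct2, THEN conjunct2, THEN conjunct1, rule_format, OF _ U(2) u])
qed

text \<open>Multiplied by the indicator function of \<open>U\<close>, the two fields agree
  everywhere, also outside \<open>U\<close>. At \<open>p\<close> that function has value 1 and
  derivative 0, so the Leibniz rule returns the original covariant derivatives.\<close>

lemma connection_local:
  assumes nabla: "affine_connection A nabla" and U: "open U" "p \<in> U"
    and Y: "vector_field A U Y" "vector_field A U Z" "\<And>q. q \<in> U \<Longrightarrow> Y q = Z q"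
    and u: "u \<in> tangent_space A p"
  shows "nabla p u Y = nabla p u Z"
proof -
  let ?h = "\<lambda>q. if q \<in> U then 1 else 0 :: real"
  have loc: "?h (chart_inv c y) = 1" if "c \<in> A" "y \<in> chart_map c ` (chart_dom c \<inter> U)" for c y
    using that by (auto simp: chart_inv_chart_map is_chart)
  have sm: "smooth_fun A U ?h" unfolding smooth_fun_def
  proof
    fix c assume c: "c \<in> A"
    have "smooth_on (chart_map c ` (chart_dom c \<inter> U)) (\<lambda>_. 1::real)"
      unfolding smooth_on_def by (intro allI C_k_const open_chart_image' c U)
    then show "smooth_on (chart_map c ` (chart_dom c \<inter> U)) (?h \<circ> chart_inv c)"
      by (rule smooth_on_cong[OF open_chart_image'[OF c U(1)], rotated]) (simp only: o_def loc[OF c])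
  qed
  let ?c = "chart_at A p"
  have c: "?c \<in> charts_at A p" "?c \<in> A" using chart_at_mem by (auto simp: charts_at_def)
  have "(?h \<circ> chart_inv ?c has_derivative (\<lambda>_. 0)) (at (chart_map ?c p))"
    by (rule has_derivative_transform_within_open[OF has_derivative_const open_chart_image'[OF c(2) U(1)]])
      (use c U loc[OF c(2)] in \<open>auto simp: charts_at_def\<close>)
  from directional_derivative_eq[OF c(1) u this] have d0: "directional_derivative A p u ?h = 0" by simp
  have "nabla p u (\<lambda>q. ?h q *\<^sub>R X q) = directional_derivative A p u ?h *\<^sub>R X p + ?h p *\<^sub>R nabla p u X"
    if "vector_field A U X" for X
    using connection_scale[OF nabla U that u sm] .
  then have scale: "nabla p u (\<lambda>q. ?h q *\<^sub>R X q) = nabla p u X" if "vector_field A U X" for X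
    using U(2) that unfolding d0 by simp
  have "(\<lambda>q. ?h q *\<^sub>R Y q) = (\<lambda>q. ?h q *\<^sub>R Z q)" using Y(3) by auto
  then show ?thesis using scale[OF Y(1)] scale[OF Y(2)] by (simp only:)
qed

lemma connection_zero:
  assumes nabla: "affine_connection A nabla" and U: "open U" "p \<in> U" and u: "u \<in> tangent_space A p"
  shows "nabla p u (\<lambda>q. 0) = 0"
proof -
  have "vector_field A U (\<lambda>q. 0)"
    using vector_field_sum[OF U(1), of "{}"] by simp
  from connection_add[OF nabla U this u this] show ?thesis by simp
qed

lemma connection_sum:
  assumes nabla: "affine_connection A nabla" and U: "open U" "p \<in> U"
    and u: "u \<in> tangent_space A p" and "finite I"
    and "\<And>i. i \<in> I \<Longrightarrow> vector_field A U (Y i)"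
  shows "nabla p u (\<lambda>q. \<Sum>i\<in>I. Y i q) = (\<Sum>i\<in>I. nabla p u (Y i))"
  using assms(5,6)
proof (induction I rule: finite_induct)
  case empty
  show ?case using connection_zero[OF nabla U u] by (simp only: sum.empty)
next
  case (insert i I)
  have "vector_field A U (\<lambda>q. \<Sum>i\<in>I. Y i q)" using insert by (intro vector_field_sum U) auto
  from connection_add[OF nabla U insert.prems[OF insertI1] u this]
  show ?case using insert.IH[OF insert.prems] by (simp only: sum.insert[OF insert.hyps] insertI2)
qed

text \<open>The Christoffel symbols contracted with both vectors. The explicit sum makes linearity
  in \<open>e\<close> available for every \<open>nabla\<close>, connection or not.\<close>

definition christoffel :: "('m, 'e) conn \<Rightarrow> ('m, 'e) chart \<Rightarrow> 'm \<Rightarrow> 'e \<Rightarrow> 'e \<Rightarrow> 'e" where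
  "christoffel nabla c p a e =
     (\<Sum>i\<in>Basis. (e \<bullet> i) *\<^sub>R nabla p (tangent_vector A c p a) (\<lambda>q. tangent_vector A c q i) c)"

text \<open>Expanding \<open>Y\<close> in the coordinate frame, the Leibniz rule separates the
  derivative of the coefficients from that of the frame. The expansion holds only inside the chart,
  which is why locality of the connection is needed.\<close>

lemma connection_component:
  assumes nabla: "affine_connection A nabla" and U: "open U" "p \<in> U" and Y: "vector_field A U Y"
    and u: "u \<in> tangent_space A p" and c: "c \<in> charts_at A p"
  shows "nabla p u Y c = frechet_derivative (\<lambda>y. Y (chart_inv c y) c) (at (chart_map c p)) (u c)
           + christoffel nabla c p (u c) (Y p c)"
proof -
  define W where "W = U \<inter> chart_dom c"
  define E where "E i q = tangent_vector A c q i" for i q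
  define Y' where "Y' = frechet_derivative (\<lambda>y. Y (chart_inv c y) c) (at (chart_map c p))"
  have cA: "c \<in> A" using c by (simp add: charts_at_def)
  have W: "open W" "p \<in> W" "W \<subseteq> chart_dom c"
    using U c open_dom[OF cA] by (auto simp: W_def charts_at_def)
  have YW: "vector_field A W Y" using vector_field_subset[OF Y] by (auto simp: W_def)
  have EW: "vector_field A W (E i)" for i
    unfolding E_def using vector_field_subset[OF vector_field_coordinate[OF cA] W(3)] .
  have sm: "smooth_fun A W (\<lambda>q. Y q c \<bullet> i)" for i
    by (rule smooth_fun_component[OF YW W(1,3) cA])
  have hYE: "vector_field A W (\<lambda>q. (Y q c \<bullet> i) *\<^sub>R E i q)" for i
    by (rule vector_field_scale[OF W(1) sm EW])
  have dY: "((\<lambda>y. Y (chart_inv c y) c) has_derivative Y') (at (chart_map c p))"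
    unfolding Y'_def using vector_field_has_derivative[OF YW c W(2)] .
  have dd: "directional_derivative A p u (\<lambda>q. Y q c \<bullet> i) = Y' (u c) \<bullet> i" for i
    by (rule directional_derivative_eq[OF c u, of _ "\<lambda>v. Y' v \<bullet> i"])
      (use has_derivative_inner_left[OF dY] in \<open>simp add: o_def\<close>)
  have "nabla p u Y = nabla p u (\<lambda>q. \<Sum>i\<in>Basis. (Y q c \<bullet> i) *\<^sub>R E i q)"
  proof (rule connection_local[OF nabla W(1,2) YW vector_field_sum[OF W(1) hYE] _ u])
    fix q assume q: "q \<in> W"
    then have cq: "c \<in> charts_at A q" using cA W by (auto simp: charts_at_def)
    have "Y q = tangent_vector A c q (Y q c)"
      using YW q by (intro tangent_vector_of_component[OF cq, symmetric]) (auto simp: vector_field_def)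
    also have "\<dots> = (\<Sum>i\<in>Basis. (Y q c \<bullet> i) *\<^sub>R E i q)"
      unfolding E_def by (rule linear_Basis_expansion[OF tangent_vector_linear[OF cq]])
    finally show "Y q = (\<Sum>i\<in>Basis. (Y q c \<bullet> i) *\<^sub>R E i q)" .
  qed
  also have "\<dots> = (\<Sum>i\<in>Basis. nabla p u (\<lambda>q. (Y q c \<bullet> i) *\<^sub>R E i q))"
    by (rule connection_sum[OF nabla W(1,2) u finite_Basis hYE])
  also have "\<dots> = (\<Sum>i\<in>Basis. (Y' (u c) \<bullet> i) *\<^sub>R E i p + (Y p c \<bullet> i) *\<^sub>R nabla p u (E i))"
    unfolding dd[symmetric] by (intro sum.cong refl connection_scale[OF nabla W(1,2) EW u sm])
  finally have "nabla p u Y c = (\<Sum>i\<in>Basis. (Y' (u c) \<bullet> i) *\<^sub>R i) + (\<Sum>i\<in>Basis. (Y p c \<bullet> i) *\<^sub>R nabla p u (E i) c)"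
    by (simp add: sum_fun_component scaleR_fun_def sum.distrib E_def c)
  then show ?thesis
    using tangent_vector_of_component[OF c u]
    by (simp add: euclidean_representation christoffel_def E_def[abs_def] Y'_def)
qed

lemma christoffel_linear_right: "linear (christoffel nabla c p a)"
  by (rule linearI) (simp_all add: christoffel_def inner_add_left scaleR_add_left sum.distrib scaleR_sum_right)

lemma frechet_derivative_coordinate:
  assumes c: "c \<in> charts_at A p"
  shows "frechet_derivative (\<lambda>y. tangent_vector A c (chart_inv c y) a c) (at (chart_map c p)) = (\<lambda>_. 0)"
proof (rule has_derivative_frechet, rule has_derivative_transform_within_open[OF has_derivative_const])
  have cA: "c \<in> A" and p: "p \<in> chart_dom c" using c by (auto simp: charts_at_def)
  show "open (chart_map c ` (chart_dom c \<inter> UNIV))" by (rule open_chart_image'[OF cA]) simp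
  show "chart_map c p \<in> chart_map c ` (chart_dom c \<inter> UNIV)" using p by simp
  fix y assume "y \<in> chart_map c ` (chart_dom c \<inter> UNIV)"
  then obtain q where "y = chart_map c q" "q \<in> chart_dom c" by auto
  then show "a = tangent_vector A c (chart_inv c y) a c"
    using charts_atI[OF cA] by simp
qed

lemma connection_coordinate:
  assumes nabla: "affine_connection A nabla" and c: "c \<in> charts_at A p" and u: "u \<in> tangent_space A p"
  shows "nabla p u (\<lambda>q. tangent_vector A c q e) c = christoffel nabla c p (u c) e"
proof -
  have cA: "c \<in> A" and p: "p \<in> chart_dom c" using c by (auto simp: charts_at_def)
  show ?thesis
    using connection_component[OF nabla open_dom[OF cA] p vector_field_coordinate[OF cA] u c] c
    by (simp add: frechet_derivative_coordinate)
qed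

text \<open>Coordinate fields have constant components, so their bracket vanishes and the torsion
  condition reduces to symmetry.\<close>

lemma christoffel_symmetric:
  assumes lc: "levi_civita_connection A g nabla" and c: "c \<in> charts_at A p"
  shows "christoffel nabla c p a e = christoffel nabla c p e a"
proof -
  let ?E = "\<lambda>a q. tangent_vector A c q a"
  have nabla: "affine_connection A nabla" using lc by (simp add: levi_civita_connection_def)
  have cA: "c \<in> A" and p: "p \<in> chart_dom c" using c by (auto simp: charts_at_def)
  note E = vector_field_coordinate[OF cA] and o = open_dom[OF cA]
  have "nabla p (?E a p) (?E e) - nabla p (?E e p) (?E a) = lie_bracket A (?E a) (?E e) p"
    using lc[unfolded levi_civita_connection_def, THEN conjunct2, rule_format, OF o E E, THEN conjunct1] p
    by (rule bspec)
  from fun_cong[OF this, of c] show ?thesis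
    using c by (simp add: lie_bracket_def frechet_derivative_coordinate
      connection_coordinate[OF nabla c tangent_vector_mem[OF c]])
qed

end

section \<open>Metrics and tensor fields at a point\<close>

lemma
  assumes "semi_riemannian_metric A g"
    and "u \<in> tangent_space A q" "v \<in> tangent_space A q" "w \<in> tangent_space A q"
  shows metric_add: "g q (u + v) w = g q u w + g q v w"
    and metric_scale: "g q (r *\<^sub>R u) w = r * g q u w"
    and metric_sym: "g q u w = g q w u"
proof -
  note m = assms(1)[unfolded semi_riemannian_metric_def, THEN conjunct1, rule_format, OF assms(2-4)]
  show "g q (u + v) w = g q u w + g q v w" by (rule m[THEN conjunct1])
  show "g q (r *\<^sub>R u) w = r * g q u w" by (rule m[THEN conjunct2, THEN conjunct1])
  show "g q u w = g q w u" by (rule m[THEN conjunct2, THEN conjunct2])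
qed

lemma tensor_field_11_mem:
  assumes "tensor_field_11 A T" "u \<in> tangent_space A q"
  shows "T q u \<in> tangent_space A q"
  by (rule assms(1)[unfolded tensor_field_11_def, THEN conjunct1, rule_format, OF assms(2)])

lemma
  assumes "tensor_field_11 A T" "u \<in> tangent_space A q" "v \<in> tangent_space A q"
  shows tensor_field_11_add: "T q (u + v) = T q u + T q v"
    and tensor_field_11_scale: "T q (r *\<^sub>R u) = r *\<^sub>R T q u"
proof -
  note m = assms(1)[unfolded tensor_field_11_def, THEN conjunct2, THEN conjunct1, rule_format, OF assms(2,3)]
  show "T q (u + v) = T q u + T q v" by (rule m[THEN conjunct1])
  show "T q (r *\<^sub>R u) = r *\<^sub>R T q u" by (rule m[THEN conjunct2])
qed

lemma tensor_field_11_vector_field: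
  assumes "tensor_field_11 A T" "open U" "vector_field A U X"
  shows "vector_field A U (\<lambda>q. T q (X q))"
  by (rule assms(1)[unfolded tensor_field_11_def, THEN conjunct2, THEN conjunct2, rule_format, OF assms(2,3)])

section \<open>Immersions in charts\<close>

locale immersion_at = A: atlas A + B: atlas B
  for A :: "('m::{t2_space,second_countable_topology}, 'e::euclidean_space) chart set"
    and B :: "('s::{t2_space,second_countable_topology}, 'd::euclidean_space) chart set" +
  fixes f :: "'s \<Rightarrow> 'm" and p :: 's
  assumes immersed: "immersed_submanifold B A f"
begin

text \<open>These are the charts that \<open>differential\<close>,
  \<open>directional_derivative\<close> and \<open>induced_connection\<close> select at
  \<open>p\<close>; fixing them on the neighbourhood \<open>N\<close> makes it possible to
  differentiate there.\<close>

definition b where "b = chart_at B p"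
definition c where "c = chart_at A (f p)"
definition N where "N = chart_dom b \<inter> f -` chart_dom c"
definition F where "F = chart_map c \<circ> f \<circ> chart_inv b"
definition J where "J x = frechet_derivative F (at x)"
definition x0 where "x0 = chart_map b p"

lemma b: "b \<in> charts_at B p" "b \<in> B" and c: "c \<in> charts_at A (f p)" "c \<in> A"
  using A.chart_at_mem B.chart_at_mem by (auto simp: b_def c_def charts_at_def)

lemma p_in_N: "p \<in> N"
  using b c by (auto simp: N_def charts_at_def)

lemma charts_at_N: "q \<in> N \<Longrightarrow> b \<in> charts_at B q" "q \<in> N \<Longrightarrow> c \<in> charts_at A (f q)"
  using b c by (auto simp: N_def charts_at_def)

lemma f_continuous: "open U \<Longrightarrow> open (f -` U)"
  using immersed continuous_on_open_vimage[OF open_UNIV]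
  by (auto simp: immersed_submanifold_def smooth_map_def)

lemma open_image_N: "open U \<Longrightarrow> open (chart_map b ` (N \<inter> U))"
  using B.open_chart_image'[OF b(2), of "f -` chart_dom c \<inter> U"] f_continuous[OF A.open_dom[OF c(2)]]
  by (simp add: N_def Int_assoc open_Int)

lemma smooth_rep:
  "b' \<in> B \<Longrightarrow> c' \<in> A \<Longrightarrow> smooth_on (chart_map b' ` (chart_dom b' \<inter> f -` chart_dom c')) (chart_map c' \<circ> f \<circ> chart_inv b')"
  using immersed by (auto simp: immersed_submanifold_def smooth_map_def)

lemma F_smooth: "smooth_on (chart_map b ` N) F"
  unfolding F_def N_def by (intro smooth_rep b c)

lemma J_has_derivative: "q \<in> N \<Longrightarrow> (F has_derivative J (chart_map b q)) (at (chart_map b q))"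
  unfolding J_def by (intro smooth_on_has_derivative[OF F_smooth]) auto

lemma J_linear: "q \<in> N \<Longrightarrow> linear (J (chart_map b q))"
  using J_has_derivative has_derivative_linear by blast

lemma J_direction_has_derivative:
  "((\<lambda>x. J x e) has_derivative frechet_derivative (\<lambda>x. J x e) (at x0)) (at x0)"
  unfolding J_def
  by (rule C_k_Suc_has_derivative[of 0, OF smooth_on_C_k_derivative[OF F_smooth]])
    (use p_in_N in \<open>auto simp: x0_def\<close>)

text \<open>The definition selects new charts at every point \<open>q\<close>. The chain rule in
  source and target brings all of these back to the fixed pair \<open>b\<close>, \<open>c\<close>,
  so that the differential becomes one smoothly varying linear map.\<close>

lemma differential_component:
  assumes q: "q \<in> N" and u: "u \<in> tangent_space B q"
  shows "differential B A f q u c = J (chart_map b q) (u b)"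
proof -
  define b' where "b' = chart_at B q"
  define c' where "c' = chart_at A (f q)"
  have b': "b' \<in> charts_at B q" "b' \<in> B" and c': "c' \<in> charts_at A (f q)" "c' \<in> A"
    using A.chart_at_mem B.chart_at_mem by (auto simp: b'_def c'_def charts_at_def)
  note bq = charts_at_N(1)[OF q] and cq = charts_at_N(2)[OF q]
  let ?G = "chart_map c' \<circ> f \<circ> chart_inv b'" and ?t = "chart_map c \<circ> chart_inv c'"
  let ?S = "chart_map b' ` (chart_dom b' \<inter> f -` (chart_dom c' \<inter> chart_dom c))"
  have S: "open ?S" "chart_map b' q \<in> ?S"
    using bq cq b' c' by (auto simp: charts_at_def intro!: B.open_chart_image' f_continuous A.open_dom)
  have dG: "(?G has_derivative frechet_derivative ?G (at (chart_map b' q))) (at (chart_map b' q))"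
    by (rule smooth_on_has_derivative[OF smooth_rep[OF b'(2) c'(2)]])
      (use b' c' in \<open>auto simp: charts_at_def\<close>)
  have dt: "(?t has_derivative frechet_derivative ?t (at (chart_map c' (f q)))) (at (?G (chart_map b' q)))"
    using A.has_derivative_transition[OF c'(1) cq] b' by simp
  have "(chart_map c \<circ> f \<circ> chart_inv b' has_derivative
      frechet_derivative ?t (at (chart_map c' (f q))) \<circ> frechet_derivative ?G (at (chart_map b' q))) (at (chart_map b' q))"
    by (rule has_derivative_transform_within_open[OF diff_chain_at[OF dG dt] S])
      (use b' c' in \<open>auto simp: chart_inv_chart_map A.is_chart B.is_chart\<close>)
  from has_derivative_frechet(1)[OF this]
    has_derivative_frechet(1)[OF B.has_derivative_change_chart[OF bq b'(1), of "chart_map c \<circ> f", folded F_def, OF J_has_derivative[OF q]]]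
  have "frechet_derivative ?t (at (chart_map c' (f q))) (frechet_derivative ?G (at (chart_map b' q)) (u b'))
      = J (chart_map b q) (frechet_derivative (chart_map b \<circ> chart_inv b') (at (chart_map b' q)) (u b'))"
    by (metis comp_apply)
  then show ?thesis
    using B.tangent_space_component[OF u b'(1) bq] cq
    by (simp add: differential_def tangent_vector_def b'_def[symmetric] c'_def[symmetric])
qed

lemma differential_mem: "differential B A f q u \<in> tangent_space A (f q)"
  by (simp add: differential_def Let_def A.tangent_vector_mem A.chart_at_mem)

lemma differential_eq:
  "q \<in> N \<Longrightarrow> u \<in> tangent_space B q \<Longrightarrow> differential B A f q u = tangent_vector A c (f q) (J (chart_map b q) (u b))"
  by (metis differential_component differential_mem A.tangent_vector_of_component charts_at_N(2))

lemma sub_tangent_iff: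
  assumes q: "q \<in> N"
  shows "w \<in> sub_tangent B A f q \<longleftrightarrow> w \<in> tangent_space A (f q) \<and> w c \<in> range (J (chart_map b q))"
proof
  assume "w \<in> sub_tangent B A f q"
  then show "w \<in> tangent_space A (f q) \<and> w c \<in> range (J (chart_map b q))"
    using differential_component[OF q] differential_mem by (auto simp: sub_tangent_def)
next
  assume w: "w \<in> tangent_space A (f q) \<and> w c \<in> range (J (chart_map b q))"
  then obtain a where a: "w c = J (chart_map b q) a" by auto
  note bq = charts_at_N(1)[OF q] and cq = charts_at_N(2)[OF q]
  have "w = differential B A f q (tangent_vector B b q a)"
    using A.tangent_vector_of_component[OF cq, of w] w a bq
    by (simp add: differential_eq[OF q B.tangent_vector_mem[OF bq]])
  then show "w \<in> sub_tangent B A f q"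
    using B.tangent_vector_mem[OF bq] by (auto simp: sub_tangent_def)
qed

lemma sub_tangent_p_iff:
  "w \<in> sub_tangent B A f p \<longleftrightarrow> w \<in> tangent_space A (f p) \<and> w c \<in> range (J x0)"
  unfolding x0_def by (rule sub_tangent_iff[OF p_in_N])

lemma tangent_vector_sub_tangent:
  "tangent_vector A c (f p) y \<in> sub_tangent B A f p \<longleftrightarrow> y \<in> range (J x0)"
  using c A.tangent_vector_mem by (simp add: sub_tangent_p_iff)

lemma J_x0_linear: "linear (J x0)"
  unfolding x0_def by (rule J_linear[OF p_in_N])

lemma subspace_range_J: "subspace (range (J x0))"
  by (rule linear_subspace_image[OF J_x0_linear]) simp

lemma J_x0_inj: "inj (J x0)"
proof (rule injI)
  fix a e assume "J x0 a = J x0 e"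
  then have "differential B A f p (tangent_vector B b p a) = differential B A f p (tangent_vector B b p e)"
    using differential_eq[OF p_in_N B.tangent_vector_mem[OF b(1)]] b by (simp add: x0_def)
  moreover have "inj_on (differential B A f p) (tangent_space B p)"
    using immersed by (auto simp: immersed_submanifold_def)
  ultimately have "tangent_vector B b p a = tangent_vector B b p e"
    using B.tangent_vector_mem[OF b(1)] by (auto dest: inj_onD)
  then show "a = e" using b B.tangent_vector_component by metis
qed

lemma subspace_sub_tangent: "subspace (sub_tangent B A f p)"
proof -
  have "sub_tangent B A f p = tangent_vector A c (f p) ` range (J x0)"
    using sub_tangent_p_iff tangent_vector_sub_tangent A.tangent_vector_of_component[OF c(1)] by (auto simp: image_iff) metis
  then show ?thesis
    by (simp add: linear_subspace_image A.tangent_vector_linear c subspace_range_J)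
qed

section \<open>The second fundamental form in charts\<close>

text \<open>This value represents the second fundamental form only modulo \<open>range (J x0)\<close>.\<close>

definition sff :: "('m, 'e) conn \<Rightarrow> 'd \<Rightarrow> 'd \<Rightarrow> 'e" where
  "sff nabla a e = frechet_derivative (\<lambda>x. J x e) (at x0) a + A.christoffel nabla c (f p) (J x0 a) (J x0 e)"

text \<open>Each summand is symmetric by itself: the second derivatives of \<open>F\<close> commute,
  and so do the arguments of the Christoffel term.\<close>

lemma sff_symmetric:
  assumes "levi_civita_connection A g nabla"
  shows "sff nabla a e = sff nabla e a"
proof -
  have "C_k 2 F (chart_map b ` (N \<inter> UNIV))" "x0 \<in> chart_map b ` (N \<inter> UNIV)"
    using F_smooth p_in_N by (auto simp: smooth_on_def x0_def)
  from frechet_derivative_commute[OF open_image_N[OF open_UNIV] this(2,1)]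
  show ?thesis
    unfolding sff_def J_def A.christoffel_symmetric[OF assms c(1), of "frechet_derivative F (at x0) a"] by simp
qed

text \<open>Modulo tangent vectors, differentiating a tangent field only differentiates the frame
  \<open>J\<close>, so just the coefficient vector \<open>e\<close> at \<open>p\<close> matters.
  This serves three kinds of fields: pushed forward fields, restrictions of ambient fields, and
  images under an invariant tensor field.\<close>

lemma tangential_covariant_derivative:
  assumes U: "open U" "p \<in> U"
    and V: "\<And>q. q \<in> N \<inter> U \<Longrightarrow> V q \<in> sub_tangent B A f q"
    and dV: "((\<lambda>x. V (chart_inv b x) c) has_derivative V') (at x0)"
    and e: "V p c = J x0 e"
  shows "V' a + A.christoffel nabla c (f p) (J x0 a) (V p c) - sff nabla a e \<in> range (J x0)"
proof -
  let ?S = "chart_map b ` (N \<inter> U)"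
  have x0: "x0 \<in> ?S" using p_in_N U by (auto simp: x0_def)
  have inv: "chart_inv b (chart_map b q) = q" if "q \<in> N" for q
    using charts_at_N(1)[OF that] by simp
  \<comment> \<open>The coefficients are chosen arbitrarily at each point; only at \<open>x0\<close>
    is the given value \<open>e\<close> prescribed.\<close>
  define z where "z x = (if x = x0 then e else (SOME y. V (chart_inv b x) c = J x y))" for x
  have "V (chart_inv b x) c = J x (z x)" if "x \<in> ?S" for x
  proof (cases "x = x0")
    case True
    then show ?thesis using e inv[OF p_in_N] by (simp add: z_def x0_def)
  next
    case False
    from that obtain q where q: "q \<in> N" "q \<in> U" "x = chart_map b q" by auto
    then have "\<exists>y. V (chart_inv b x) c = J x y"
      using V[of q] by (auto simp: sub_tangent_iff inv)
    then show ?thesis using False by (auto simp: z_def intro: someI_ex)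
  qed
  moreover have "z x0 = e" by (simp add: z_def)
  moreover have "isCont (\<lambda>x. J x v) x0" for v
    using J_direction_has_derivative has_derivative_continuous by blast
  ultimately have "V' a - frechet_derivative (\<lambda>x. J x e) (at x0) a \<in> range (J x0)"
    using J_direction_has_derivative[of e] J_linear dV
    by (intro tangential_derivative[where J = J and z = z, OF open_image_N[OF U(1)] x0 _ J_x0_inj]) auto
  then show ?thesis by (simp add: sff_def e)
qed

lemma induced_connection_component:
  assumes nabla: "affine_connection A nabla" and u: "u \<in> tangent_space B p"
    and dV: "((\<lambda>x. V (chart_inv b x) c) has_derivative V') (at x0)"
  shows "induced_connection B A nabla f p u V \<in> tangent_space A (f p)"
    and "induced_connection B A nabla f p u V c = V' (u b) + A.christoffel nabla c (f p) (J x0 (u b)) (V p c)"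
proof -
  let ?E = "\<lambda>i q. tangent_vector A c q i" and ?w = "differential B A f p u"
  have E: "vector_field A (chart_dom c) (?E i)" for i by (rule A.vector_field_coordinate[OF c(2)])
  have fp: "f p \<in> chart_dom c" using c by (auto simp: charts_at_def)
  have nE: "nabla (f p) ?w (?E i) \<in> tangent_space A (f p)" for i
    by (rule A.connection_mem[OF nabla A.open_dom[OF c(2)] fp E differential_mem])
  have dd: "directional_derivative B p u (\<lambda>q. V q c \<bullet> i) = V' (u b) \<bullet> i" for i
    by (rule B.directional_derivative_eq[OF b(1) u, of _ "\<lambda>v. V' v \<bullet> i"])
      (use has_derivative_inner_left[OF dV] in \<open>simp add: o_def x0_def\<close>)
  have eq: "induced_connection B A nabla f p u V =
      (\<Sum>i\<in>Basis. (V' (u b) \<bullet> i) *\<^sub>R ?E i (f p) + (V p c \<bullet> i) *\<^sub>R nabla (f p) ?w (?E i))"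
    by (simp add: induced_connection_def c_def[symmetric] Let_def dd)
  show "induced_connection B A nabla f p u V \<in> tangent_space A (f p)"
    unfolding eq using A.tangent_vector_mem[OF c(1)] nE A.subspace_tangent_space
    by (intro subspace_sum subspace_add subspace_scale) auto
  have "?w = tangent_vector A c (f p) (J x0 (u b))"
    using differential_eq[OF p_in_N u] by (simp add: x0_def)
  then show "induced_connection B A nabla f p u V c = V' (u b) + A.christoffel nabla c (f p) (J x0 (u b)) (V p c)"
    unfolding eq using c
    by (simp add: sum_fun_component scaleR_fun_def sum.distrib A.christoffel_def euclidean_representation)
qed

text \<open>The derivatives of the coefficients of \<open>Y\<close> contribute only tangent vectors.
  Hence the second fundamental form depends on the two fields only through their values at
  \<open>p\<close>.\<close>

lemma induced_connection_sff:
  assumes nabla: "affine_connection A nabla" and U: "open U" "p \<in> U"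
    and Y: "vector_field B U Y" and u: "u \<in> tangent_space B p"
  defines "D \<equiv> induced_connection B A nabla f p u (\<lambda>q. differential B A f q (Y q))"
  shows "D \<in> tangent_space A (f p)" and "D c - sff nabla (u b) (Y p b) \<in> range (J x0)"
proof -
  let ?V = "\<lambda>q. differential B A f q (Y q)"
  let ?S = "chart_map b ` (N \<inter> U)"
  have x0: "x0 \<in> ?S" using p_in_N U by (auto simp: x0_def)
  have YT: "Y q \<in> tangent_space B q" if "q \<in> U" for q using Y that by (auto simp: vector_field_def)
  have "((\<lambda>x. Y (chart_inv b x) b \<bullet> j) has_derivative
      (\<lambda>v. frechet_derivative (\<lambda>x. Y (chart_inv b x) b) (at x0) v \<bullet> j)) (at x0)" for j
    using B.vector_field_has_derivative[OF Y b(1) U(2)] unfolding x0_def by (rule has_derivative_inner_left)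
  \<comment> \<open>The formula for this derivative is never evaluated: the same expression occurs
    in the induced connection and in \<open>tangential_covariant_derivative\<close>.\<close>
  then have "((\<lambda>x. \<Sum>j\<in>Basis. (Y (chart_inv b x) b \<bullet> j) *\<^sub>R J x j) has_derivative
      (\<lambda>v. \<Sum>j\<in>Basis. (Y (chart_inv b x0) b \<bullet> j) *\<^sub>R frechet_derivative (\<lambda>x. J x j) (at x0) v +
        (frechet_derivative (\<lambda>x. Y (chart_inv b x) b) (at x0) v \<bullet> j) *\<^sub>R J x0 j)) (at x0)"
    (is "(_ has_derivative ?V') _")
    by (intro has_derivative_sum has_derivative_scaleR J_direction_has_derivative)
  then have dV: "((\<lambda>x. ?V (chart_inv b x) c) has_derivative ?V') (at x0)"
  proof (rule has_derivative_transform_within_open[OF _ open_image_N[OF U(1)] x0])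
    fix x assume "x \<in> ?S"
    then obtain q where q: "q \<in> N" "q \<in> U" "x = chart_map b q" by auto
    then show "(\<Sum>j\<in>Basis. (Y (chart_inv b x) b \<bullet> j) *\<^sub>R J x j) = ?V (chart_inv b x) c"
      using charts_at_N(1)[OF q(1)] linear_Basis_expansion[OF J_linear[OF q(1)], of "Y q b"]
      by (simp add: differential_component YT)
  qed
  show "D \<in> tangent_space A (f p)"
    unfolding D_def by (rule induced_connection_component[where V = ?V, OF nabla u dV])
  have Vp: "?V p c = J x0 (Y p b)"
    using differential_component[OF p_in_N YT[OF U(2)]] by (simp add: x0_def)
  have "?V q \<in> sub_tangent B A f q" if "q \<in> N \<inter> U" for q
    using that YT by (auto simp: sub_tangent_def)
  from tangential_covariant_derivative[where V = ?V, OF U this dV Vp, of "u b" nabla]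
  show "D c - sff nabla (u b) (Y p b) \<in> range (J x0)"
    unfolding D_def induced_connection_component(2)[where V = ?V, OF nabla u dV] .
qed

section \<open>The tangent space at \<open>p\<close>, parametrized by the model space, and its
  normal complement\<close>

definition push :: "'d \<Rightarrow> ('m, 'e) tvec" where
  "push a = tangent_vector A c (f p) (J x0 a)"

lemma push_mem: "push a \<in> sub_tangent B A f p" "push a \<in> tangent_space A (f p)"
  using c A.tangent_vector_mem by (auto simp: push_def tangent_vector_sub_tangent)

lemma push_component [simp]: "push a c = J x0 a"
  using c by (simp add: push_def)

lemma push_linear: "linear push"
  unfolding push_def
  using linear_compose[OF J_x0_linear A.tangent_vector_linear[OF c(1)]] by (simp add: o_def)

lemma sub_tangent_eq_range_push: "sub_tangent B A f p = range push"
proof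
  show "sub_tangent B A f p \<subseteq> range push"
  proof
    fix w assume "w \<in> sub_tangent B A f p"
    then obtain a where "w \<in> tangent_space A (f p)" "w c = J x0 a" by (auto simp: sub_tangent_p_iff)
    then have "w = push a" using A.tangent_vector_of_component[OF c(1), of w] by (simp add: push_def)
    then show "w \<in> range push" by simp
  qed
qed (use push_mem(1) in blast)

text \<open>The metric may be indefinite, so nondegeneracy replaces positivity: it makes the Gram
  map of the tangent space injective, hence surjective in finite dimension, and solving a linear
  system gives the tangent part of \<open>z\<close>.\<close>

lemma normal_decomposition:
  assumes metric: "semi_riemannian_metric A g" and nondeg: "nondegenerate_submanifold B A g f"
    and z: "z \<in> tangent_space A (f p)"
  shows "\<exists>n \<in> sub_normal B A g f p. z - n \<in> sub_tangent B A f p"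
proof -
  have add: "g (f p) (u + v) w = g (f p) u w + g (f p) v w"
    and scale: "g (f p) (r *\<^sub>R u) w = r * g (f p) u w" and sym: "g (f p) u w = g (f p) w u"
    if "u \<in> tangent_space A (f p)" "v \<in> tangent_space A (f p)" "w \<in> tangent_space A (f p)" for r u v w
    using metric_add[OF metric that] metric_scale[OF metric that] metric_sym[OF metric that] by blast+
  have sc: "r *\<^sub>R u \<in> tangent_space A (f p)" if "u \<in> tangent_space A (f p)" for r u
    by (rule subspace_scale[OF A.subspace_tangent_space that])
  have ad: "u + v \<in> tangent_space A (f p)" if "u \<in> tangent_space A (f p)" "v \<in> tangent_space A (f p)" for u v
    by (rule subspace_add[OF A.subspace_tangent_space that])
  have lin: "linear (\<lambda>a. g (f p) (push a) w)" if w: "w \<in> tangent_space A (f p)" for w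
    by (rule linearI) (simp_all add: linear_add[OF push_linear] linear_cmul[OF push_linear] add scale[OF _ w] push_mem w)
  \<comment> \<open>The Gram matrix of the frame \<open>push i\<close> as a linear map of the model
    space.\<close>
  define L where "L a = (\<Sum>i\<in>Basis. g (f p) (push a) (push i) *\<^sub>R i)" for a
  have linL: "linear L"
    by (rule linearI) (simp_all add: L_def linear_add[OF lin] linear_cmul[OF lin] push_mem
      scaleR_add_left sum.distrib scaleR_sum_right)
  have expand: "g (f p) w (push e) = (\<Sum>i\<in>Basis. (e \<bullet> i) * g (f p) w (push i))"
    if w: "w \<in> tangent_space A (f p)" for w e
    using linear_Basis_expansion[OF lin[OF w], of e] sym[OF w w push_mem(2)] by simp
  have Li: "L a \<bullet> i = g (f p) (push a) (push i)" if "i \<in> Basis" for a i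
    using that by (simp add: L_def inner_sum_left inner_Basis if_distrib cong: if_cong)
  have "a = 0" if "L a = 0" for a
  proof -
    have "g (f p) (push a) (push i) = 0" if "i \<in> Basis" for i
      using Li[OF that, of a] \<open>L a = 0\<close> by simp
    then have "g (f p) (push a) (push e) = 0" for e
      using expand[OF push_mem(2), of a e] by simp
    then have "push a = 0"
      using nondeg[unfolded nondegenerate_submanifold_def, rule_format, OF push_mem(1)]
      by (auto simp: sub_tangent_eq_range_push)
    then have "J x0 a = 0" using push_component[of a] by simp
    then show "a = 0" using J_x0_inj linear_injective_0[OF J_x0_linear] by blast
  qed
  then have "inj L" using linear_injective_0[OF linL] by blast
  then have "surj L" by (rule eucl.linear_inj_imp_surj[OF linL])
  then obtain a where a: "L a = (\<Sum>i\<in>Basis. g (f p) z (push i) *\<^sub>R i)" by (metis surjD)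
  have "g (f p) (push a) (push i) = g (f p) z (push i)" if "i \<in> Basis" for i
    using Li[OF that, of a] that unfolding a by (simp add: inner_sum_left inner_Basis if_distrib cong: if_cong)
  then have eq: "g (f p) (push a) (push e) = g (f p) z (push e)" for e
    using expand[OF push_mem(2), of a e] expand[OF z, of e] by simp
  have m: "(- 1) *\<^sub>R push a \<in> tangent_space A (f p)" by (intro sc push_mem)
  have "g (f p) (z + (- 1) *\<^sub>R push a) (push e) = 0" for e
    using add[OF z m push_mem(2)] scale[OF push_mem(2) z push_mem(2), of "- 1"] eq by simp
  moreover have "z + (- 1) *\<^sub>R push a \<in> tangent_space A (f p)" by (intro ad z m)
  ultimately have "z - push a \<in> sub_normal B A g f p"
    by (auto simp: sub_normal_def sub_tangent_eq_range_push)
  then show ?thesis using push_mem(1)[of a] by (intro bexI[of _ "z - push a"]) auto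
qed

text \<open>Nondegeneracy makes the tangent and normal spaces meet only in 0, so the description in
  \<open>normal_part\<close> is unique. From here on, tangency replaces every statement about normal
  parts.\<close>

lemma normal_part_eq_0_iff:
  assumes metric: "semi_riemannian_metric A g" and nondeg: "nondegenerate_submanifold B A g f"
    and z: "z \<in> tangent_space A (f p)"
  shows "normal_part B A g f p z = 0 \<longleftrightarrow> z \<in> sub_tangent B A f p"
proof -
  have uniq: "n = n'" if n: "n \<in> sub_normal B A g f p" "z - n \<in> sub_tangent B A f p"
    and n': "n' \<in> sub_normal B A g f p" "z - n' \<in> sub_tangent B A f p" for n n'
  proof -
    have t: "n - n' \<in> sub_tangent B A f p"
      using subspace_diff[OF subspace_sub_tangent n'(2) n(2)] by simp
    have T: "n \<in> tangent_space A (f p)" "n' \<in> tangent_space A (f p)" using n n' by (auto simp: sub_normal_def)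
    have m: "(- 1) *\<^sub>R n' \<in> tangent_space A (f p)"
      by (rule subspace_scale[OF A.subspace_tangent_space T(2)])
    have "g (f p) (n - n') w = 0" if w: "w \<in> sub_tangent B A f p" for w
    proof -
      have wT: "w \<in> tangent_space A (f p)" using w sub_tangent_p_iff by blast
      have "g (f p) (n + (- 1) *\<^sub>R n') w = g (f p) n w + g (f p) ((- 1) *\<^sub>R n') w"
        "g (f p) ((- 1) *\<^sub>R n') w = - 1 * g (f p) n' w"
        using metric_add[OF metric T(1) m wT] metric_scale[OF metric T(2) m wT] by blast+
      then show ?thesis using n(1) n'(1) w by (simp add: sub_normal_def)
    qed
    then have "n - n' = 0" using nondeg t unfolding nondegenerate_submanifold_def by blast
    then show ?thesis by simp
  qed
  obtain n where n: "n \<in> sub_normal B A g f p" "z - n \<in> sub_tangent B A f p"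
    using normal_decomposition[OF assms] by blast
  have eq: "normal_part B A g f p z = n"
    unfolding normal_part_def by (rule the_equality) (use n uniq in blast)+
  show ?thesis
  proof
    assume "normal_part B A g f p z = 0"
    then show "z \<in> sub_tangent B A f p" using n(2) eq by simp
  next
    assume zt: "z \<in> sub_tangent B A f p"
    have "g (f p) (0 *\<^sub>R w) w = 0 * g (f p) w w" if "w \<in> tangent_space A (f p)" for w
      using metric_scale[OF metric that that that] .
    then have "0 \<in> sub_normal B A g f p"
      using subspace_0[OF A.subspace_tangent_space] sub_tangent_p_iff by (auto simp: sub_normal_def)
    then show "normal_part B A g f p z = 0" using uniq[OF n, of 0] zt eq by simp
  qed
qed

lemma second_fundamental_form_eq_0_iff:
  assumes metric: "semi_riemannian_metric A g" and nondeg: "nondegenerate_submanifold B A g f"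
    and nabla: "affine_connection A nabla" and U: "open U" "p \<in> U"
    and X: "vector_field B U X" and Y: "vector_field B U Y"
  shows "second_fundamental_form B A g nabla f X Y p = 0 \<longleftrightarrow> sff nabla (X p b) (Y p b) \<in> range (J x0)"
proof -
  let ?D = "induced_connection B A nabla f p (X p) (\<lambda>q. differential B A f q (Y q))"
  have "X p \<in> tangent_space B p" using X U by (auto simp: vector_field_def)
  note D = induced_connection_sff[OF nabla U Y this]
  have "second_fundamental_form B A g nabla f X Y p = 0 \<longleftrightarrow> ?D c \<in> range (J x0)"
    using D(1) by (simp add: second_fundamental_form_def normal_part_eq_0_iff[OF metric nondeg] sub_tangent_p_iff)
  also have "\<dots> \<longleftrightarrow> sff nabla (X p b) (Y p b) \<in> range (J x0)"
    by (rule subspace_mem_iff[OF subspace_range_J D(2)])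
  finally show ?thesis .
qed

text \<open>The coordinate fields of \<open>b\<close> with constant components \<open>a\<close> and
  \<open>e\<close> realize every pair of values at \<open>p\<close>.\<close>

lemma totally_geodesic_sff:
  assumes metric: "semi_riemannian_metric A g" and nondeg: "nondegenerate_submanifold B A g f"
    and nabla: "affine_connection A nabla" and tg: "totally_geodesic B A g nabla f"
  shows "sff nabla a e \<in> range (J x0)"
proof -
  have p: "p \<in> chart_dom b" using b by (auto simp: charts_at_def)
  note E = B.vector_field_coordinate[OF b(2)] and U = B.open_dom[OF b(2)]
  have "second_fundamental_form B A g nabla f (\<lambda>q. tangent_vector B b q a) (\<lambda>q. tangent_vector B b q e) p = 0"
    using tg[unfolded totally_geodesic_def, rule_format, OF U E E p] .
  then show ?thesis
    using second_fundamental_form_eq_0_iff[OF metric nondeg nabla U p E E] b by simp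
qed

text \<open>By the chain rule, differentiating \<open>Y\<close> in a tangent direction is the same
  as differentiating its restriction along the immersion. The lemma is meant for the structure
  vector fields.\<close>

lemma connection_tangent_field:
  assumes nabla: "affine_connection A nabla" and U: "open U" "f p \<in> U" and Y: "vector_field A U Y"
    and tangent: "\<And>q. f q \<in> U \<Longrightarrow> Y (f q) \<in> sub_tangent B A f q" and e: "Y (f p) c = J x0 e"
  shows "nabla (f p) (push a) Y c - sff nabla a e \<in> range (J x0)"
proof -
  let ?Y' = "frechet_derivative (\<lambda>y. Y (chart_inv c y) c) (at (chart_map c (f p)))"
  let ?S = "chart_map b ` (N \<inter> UNIV)"
  have x0: "x0 \<in> ?S" using p_in_N by (auto simp: x0_def)
  have F0: "F x0 = chart_map c (f p)" using b by (simp add: F_def x0_def)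
  have dY: "((\<lambda>y. Y (chart_inv c y) c) has_derivative ?Y') (at (F x0))"
    unfolding F0 by (rule A.vector_field_has_derivative[OF Y c(1) U(2)])
  have dF: "(F has_derivative J x0) (at x0)"
    unfolding x0_def by (rule J_has_derivative[OF p_in_N])
  have "((\<lambda>x. Y (f (chart_inv b x)) c) has_derivative (?Y' \<circ> J x0)) (at x0)"
    by (rule has_derivative_transform_within_open[OF diff_chain_at[OF dF dY] open_image_N[OF open_UNIV] x0])
      (use charts_at_N in \<open>auto simp: F_def\<close>)
  from tangential_covariant_derivative[where V = "\<lambda>q. Y (f q)", OF f_continuous[OF U(1)] _ _ this e, of a nabla]
  show ?thesis
    using A.connection_component[OF nabla U Y push_mem(2) c(1)] tangent U(2) by simp
qed

text \<open>Expanding \<open>T\<close> of the coordinate field \<open>e\<close> in the ambient coordinate frame replaces the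
  missing extension of this field to the ambient manifold.\<close>

lemma tensor_sff:
  assumes nabla: "affine_connection A nabla" and T: "tensor_field_11 A T"
    and inv: "\<And>q. T (f q) ` sub_tangent B A f q \<subseteq> sub_tangent B A f q"
    and cov: "\<And>i. cov_deriv_tensor nabla T (f p) (push a) (\<lambda>q. tangent_vector A c q i) \<in> sub_tangent B A f p"
    and e': "T (f p) (push e) = push e'"
  shows "T (f p) (tangent_vector A c (f p) (sff nabla a e)) - tangent_vector A c (f p) (sff nabla a e')
           \<in> sub_tangent B A f p"
proof -
  let ?E = "\<lambda>i q. tangent_vector A c q i"
  let ?\<Gamma> = "A.christoffel nabla c (f p) (J x0 a)"
  \<comment> \<open>The matrix of \<open>T\<close> in the chart \<open>c\<close>.\<close>
  define M where "M q y = T q (tangent_vector A c q y) c" for q y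
  have Tmem: "T q v \<in> tangent_space A q" if "v \<in> tangent_space A q" for q v
    by (rule tensor_field_11_mem[OF T that])
  have Mlin: "linear (M q)" if q: "c \<in> charts_at A q" for q
  proof (rule linearI)
    note m = A.tangent_vector_mem[OF q] and l = A.tangent_vector_linear[OF q]
    show "M q (x + y) = M q x + M q y" for x y
    proof -
      have "T q (tangent_vector A c q x + tangent_vector A c q y) = T q (tangent_vector A c q x) + T q (tangent_vector A c q y)"
        by (rule tensor_field_11_add[OF T m m])
      then show ?thesis by (simp add: M_def linear_add[OF l])
    qed
    show "M q (r *\<^sub>R x) = r *\<^sub>R M q x" for r x
    proof -
      have "T q (r *\<^sub>R tangent_vector A c q x) = r *\<^sub>R T q (tangent_vector A c q x)"
        by (rule tensor_field_11_scale[OF T m m])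
      then show ?thesis by (simp add: M_def linear_cmul[OF l] scaleR_fun_def)
    qed
  qed
  note M0 = Mlin[OF c(1)]
  have fp: "f p \<in> chart_dom c" using c by (auto simp: charts_at_def)
  note U = A.open_dom[OF c(2)] fp and E = A.vector_field_coordinate[OF c(2)]
  have TE: "vector_field A (chart_dom c) (\<lambda>q. T q (?E i q))" for i
    by (rule tensor_field_11_vector_field[OF T U(1) E])
  let ?M' = "\<lambda>i. frechet_derivative (\<lambda>y. M (chart_inv c y) i) (at (chart_map c (f p)))"
  let ?S = "chart_map b ` (N \<inter> UNIV)"
  have x0: "x0 \<in> ?S" using p_in_N by (auto simp: x0_def)
  have F0: "F x0 = chart_map c (f p)" using b by (simp add: F_def x0_def)
  have dF: "(F has_derivative J x0) (at x0)"
    unfolding x0_def by (rule J_has_derivative[OF p_in_N])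
  have dM: "((\<lambda>y. M (chart_inv c y) i) has_derivative ?M' i) (at (F x0))" for i
    using A.vector_field_has_derivative[OF TE c(1) fp] unfolding F0 M_def .
  have dMF: "((\<lambda>x. M (f (chart_inv b x)) i) has_derivative (\<lambda>v. ?M' i (J x0 v))) (at x0)" for i
    by (rule has_derivative_transform_within_open[OF diff_chain_at[OF dF dM, unfolded o_def] open_image_N[OF open_UNIV] x0])
      (use charts_at_N in \<open>auto simp: F_def\<close>)
  \<comment> \<open>The image under \<open>T\<close> of the pushed forward coordinate field
    \<open>e\<close> of \<open>b\<close>. It is tangent by invariance and has the value
    \<open>push e'\<close> at \<open>p\<close>.\<close>
  let ?V = "\<lambda>q. T (f q) (tangent_vector A c (f q) (J (chart_map b q) e))"
  let ?J' = "frechet_derivative (\<lambda>x. J x e) (at x0)"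
  let ?V' = "\<lambda>v. \<Sum>i\<in>Basis. (J x0 e \<bullet> i) *\<^sub>R ?M' i (J x0 v) + (?J' v \<bullet> i) *\<^sub>R M (f (chart_inv b x0)) i"
  have "((\<lambda>x. \<Sum>i\<in>Basis. (J x e \<bullet> i) *\<^sub>R M (f (chart_inv b x)) i) has_derivative ?V') (at x0)"
    by (intro has_derivative_sum has_derivative_scaleR dMF has_derivative_inner_left J_direction_has_derivative)
  then have dV: "((\<lambda>x. ?V (chart_inv b x) c) has_derivative ?V') (at x0)"
  proof (rule has_derivative_transform_within_open[OF _ open_image_N[OF open_UNIV] x0])
    fix x assume "x \<in> ?S"
    then obtain q where q: "q \<in> N" "x = chart_map b q" by auto
    show "(\<Sum>i\<in>Basis. (J x e \<bullet> i) *\<^sub>R M (f (chart_inv b x)) i) = ?V (chart_inv b x) c"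
      using linear_Basis_expansion[OF Mlin[OF charts_at_N(2)[OF q(1)]], of "J x e"] charts_at_N(1)[OF q(1)] q
      by (simp add: M_def)
  qed
  have Vp: "?V p = push e'" using e' by (simp add: push_def x0_def)
  have "?V q \<in> sub_tangent B A f q" if "q \<in> N \<inter> UNIV" for q
  proof -
    have "tangent_vector A c (f q) (J (chart_map b q) e) \<in> sub_tangent B A f q"
      using that charts_at_N A.tangent_vector_mem by (simp add: sub_tangent_iff)
    then show ?thesis using inv by blast
  qed
  from tangential_covariant_derivative[where V = ?V, OF open_UNIV UNIV_I this dV, of e' a nabla]
  have 1: "?V' a + ?\<Gamma> (J x0 e') - sff nabla a e' \<in> range (J x0)"
    unfolding Vp by simp
  \<comment> \<open>The covariant derivative of an endomorphism in coordinates: the derivative of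
    its matrix plus the commutator with the connection matrix.\<close>
  have "cov_deriv_tensor nabla T (f p) (push a) (?E i) c = ?M' i (J x0 a) + ?\<Gamma> (M (f p) i) - M (f p) (?\<Gamma> i)" for i
  proof -
    have "nabla (f p) (push a) (?E i) = tangent_vector A c (f p) (?\<Gamma> i)"
      using A.connection_coordinate[OF nabla c(1) push_mem(2)] A.connection_mem[OF nabla U E push_mem(2)]
        A.tangent_vector_of_component[OF c(1)] by (metis push_component)
    moreover have "nabla (f p) (push a) (\<lambda>q. T q (?E i q)) c = ?M' i (J x0 a) + ?\<Gamma> (M (f p) i)"
      using A.connection_component[OF nabla U TE push_mem(2) c(1)] by (simp add: M_def)
    ultimately show ?thesis by (simp add: cov_deriv_tensor_def M_def)
  qed
  then have "?M' i (J x0 a) + ?\<Gamma> (M (f p) i) - M (f p) (?\<Gamma> i) \<in> range (J x0)" for i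
    using cov[of i] unfolding sub_tangent_p_iff by metis
  then have "(\<Sum>i\<in>Basis. (J x0 e \<bullet> i) *\<^sub>R (?M' i (J x0 a) + ?\<Gamma> (M (f p) i) - M (f p) (?\<Gamma> i))) \<in> range (J x0)"
    by (intro subspace_sum subspace_scale subspace_range_J)
  moreover have "(\<Sum>i\<in>Basis. (J x0 e \<bullet> i) *\<^sub>R ?\<Gamma> (M (f p) i)) = ?\<Gamma> (M (f p) (J x0 e))"
    using linear_Basis_expansion[OF linear_compose[OF M0 A.christoffel_linear_right], where x = "J x0 e"] by (simp add: o_def)
  moreover have "(\<Sum>i\<in>Basis. (J x0 e \<bullet> i) *\<^sub>R M (f p) (?\<Gamma> i)) = M (f p) (?\<Gamma> (J x0 e))"
    using linear_Basis_expansion[OF linear_compose[OF A.christoffel_linear_right M0], where x = "J x0 e"] by (simp add: o_def)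
  moreover have "M (f p) (J x0 e) = J x0 e'"
    using arg_cong[OF e', of "\<lambda>v. v c"] by (simp add: M_def push_def[symmetric])
  ultimately have 2: "(\<Sum>i\<in>Basis. (J x0 e \<bullet> i) *\<^sub>R ?M' i (J x0 a)) + ?\<Gamma> (J x0 e') - M (f p) (?\<Gamma> (J x0 e)) \<in> range (J x0)"
    by (simp add: scaleR_add_right scaleR_diff_right sum.distrib sum_subtractf)
  have "?V' a = (\<Sum>i\<in>Basis. (J x0 e \<bullet> i) *\<^sub>R ?M' i (J x0 a)) + M (f p) (?J' a)"
    using linear_Basis_expansion[OF M0, of "?J' a"] b by (simp add: sum.distrib x0_def)
  \<comment> \<open>In the difference, the derivative of the matrix and the Christoffel term at
    \<open>e'\<close> cancel. What remains is \<open>M\<close> applied to both summands of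
    \<open>sff nabla a e\<close>.\<close>
  then have "?V' a + ?\<Gamma> (J x0 e') - sff nabla a e' - ((\<Sum>i\<in>Basis. (J x0 e \<bullet> i) *\<^sub>R ?M' i (J x0 a)) + ?\<Gamma> (J x0 e') - M (f p) (?\<Gamma> (J x0 e)))
    = M (f p) (sff nabla a e) - sff nabla a e'"
    by (simp add: sff_def linear_add[OF M0])
  with subspace_diff[OF subspace_range_J 1 2]
  have "M (f p) (sff nabla a e) - sff nabla a e' \<in> range (J x0)" by (simp only:)
  moreover have "T (f p) (tangent_vector A c (f p) (sff nabla a e)) - tangent_vector A c (f p) (sff nabla a e') \<in> tangent_space A (f p)"
    by (intro subspace_diff[OF A.subspace_tangent_space] Tmem A.tangent_vector_mem c)
  ultimately show ?thesis
    using c by (simp add: sub_tangent_p_iff M_def)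
qed

end

section \<open>Mixed 3-Sasakian structures\<close>

lemma
  assumes "mixed_3_structure A \<phi> \<xi> \<eta>" and \<alpha>: "\<alpha> \<in> {1,2,3}"
  shows mixed_tensor: "tensor_field_11 A (\<phi> \<alpha>)"
    and mixed_vector_field: "vector_field A UNIV (\<xi> \<alpha>)"
    and mixed_one_form: "one_form A (\<eta> \<alpha>)"
    and mixed_eta_xi: "\<eta> \<alpha> q (\<xi> \<alpha> q) = 1"
    and mixed_phi_phi: "u \<in> tangent_space A q \<Longrightarrow> \<phi> \<alpha> q (\<phi> \<alpha> q u) = tau \<alpha> *\<^sub>R (- u + \<eta> \<alpha> q u *\<^sub>R \<xi> \<alpha> q)"
proof -
  note m = assms(1)[unfolded mixed_3_structure_def]
  show "tensor_field_11 A (\<phi> \<alpha>)" "vector_field A UNIV (\<xi> \<alpha>)" "one_form A (\<eta> \<alpha>)"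
    using bspec[OF m[THEN conjunct1] \<alpha>] by blast+
  note m2 = bspec[OF m[THEN conjunct2, THEN conjunct1] \<alpha>, THEN spec, of q]
  show "\<eta> \<alpha> q (\<xi> \<alpha> q) = 1" by (rule m2[THEN conjunct1])
  show "u \<in> tangent_space A q \<Longrightarrow> \<phi> \<alpha> q (\<phi> \<alpha> q u) = tau \<alpha> *\<^sub>R (- u + \<eta> \<alpha> q u *\<^sub>R \<xi> \<alpha> q)"
    by (rule m2[THEN conjunct2, rule_format])
qed

lemma
  assumes "mixed_3_structure A \<phi> \<xi> \<eta>" and perm: "(\<alpha>, \<beta>, \<gamma>) \<in> even_perms"
  shows mixed_perm_eta: "\<eta> \<alpha> q (\<xi> \<beta> q) = 0"
    and mixed_perm_xi: "\<phi> \<alpha> q (\<xi> \<beta> q) = tau \<beta> *\<^sub>R \<xi> \<gamma> q"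
    and mixed_perm_phi: "u \<in> tangent_space A q \<Longrightarrow>
      \<phi> \<alpha> q (\<phi> \<beta> q u) - (tau \<alpha> * \<eta> \<beta> q u) *\<^sub>R \<xi> \<alpha> q = tau \<gamma> *\<^sub>R \<phi> \<gamma> q u"
    and mixed_perm_phi': "u \<in> tangent_space A q \<Longrightarrow>
      - \<phi> \<beta> q (\<phi> \<alpha> q u) + (tau \<beta> * \<eta> \<alpha> q u) *\<^sub>R \<xi> \<beta> q = tau \<gamma> *\<^sub>R \<phi> \<gamma> q u"
proof -
  note m = spec[OF bspec[OF assms(1)[unfolded mixed_3_structure_def, THEN conjunct2, THEN conjunct2] perm,
    unfolded prod.case], of q]
  show "\<eta> \<alpha> q (\<xi> \<beta> q) = 0" by (rule m[THEN conjunct1])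
  show "\<phi> \<alpha> q (\<xi> \<beta> q) = tau \<beta> *\<^sub>R \<xi> \<gamma> q"
    by (rule m[THEN conjunct2, THEN conjunct2, THEN conjunct1])
  note m' = bspec[OF m[THEN conjunct2, THEN conjunct2, THEN conjunct2, THEN conjunct2], THEN conjunct2, THEN conjunct2]
  show "u \<in> tangent_space A q \<Longrightarrow> \<phi> \<alpha> q (\<phi> \<beta> q u) - (tau \<alpha> * \<eta> \<beta> q u) *\<^sub>R \<xi> \<alpha> q = tau \<gamma> *\<^sub>R \<phi> \<gamma> q u"
    by (rule m'[THEN conjunct1])
  show "u \<in> tangent_space A q \<Longrightarrow> - \<phi> \<beta> q (\<phi> \<alpha> q u) + (tau \<beta> * \<eta> \<alpha> q u) *\<^sub>R \<xi> \<beta> q = tau \<gamma> *\<^sub>R \<phi> \<gamma> q u"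
    by (rule m'[THEN conjunct2])
qed

text \<open>The products of the \<open>\<phi> \<alpha>\<close> show that all \<open>\<phi> \<alpha> (\<xi> \<alpha>)\<close> coincide, and \<open>\<phi> \<alpha>\<^sup>2 (\<xi> \<alpha>) = 0\<close>
  makes their common value a multiple of each \<open>\<xi> \<alpha>\<close>.\<close>

lemma (in atlas) mixed_phi_xi:
  assumes m: "mixed_3_structure A \<phi> \<xi> \<eta>" and \<alpha>: "\<alpha> \<in> {1,2,3}"
  shows "\<phi> \<alpha> q (\<xi> \<alpha> q) = 0"
proof -
  define v where "v = \<phi> 1 q (\<xi> 1 q)"
  have i: "1 \<in> {1,2,3::nat}" "2 \<in> {1,2,3::nat}" "3 \<in> {1,2,3::nat}" by auto
  have e: "(1, 2, 3) \<in> even_perms" "(2, 3, 1) \<in> even_perms" "(3, 1, 2) \<in> even_perms"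
    by (auto simp: even_perms_def)
  have x: "\<xi> \<beta> q \<in> tangent_space A q" if "\<beta> \<in> {1,2,3}" for \<beta>
    using mixed_vector_field[OF m that] by (auto simp: vector_field_def)
  have v: "v \<in> tangent_space A q"
    unfolding v_def by (rule tensor_field_11_mem[OF mixed_tensor[OF m i(1)] x[OF i(1)]])
  \<comment> \<open>The relation for \<open>\<phi> 1\<close> after \<open>\<phi> 2\<close>,
    evaluated at \<open>\<xi> 3\<close>, where \<open>\<phi> 2\<close> gives \<open>\<xi> 1\<close>
    and \<open>\<eta> 2\<close> vanishes.\<close>
  have 3: "\<phi> 3 q (\<xi> 3 q) = v"
    using mixed_perm_phi[OF m e(1) x[OF i(3)]] mixed_perm_xi[OF m e(2), of q] mixed_perm_eta[OF m e(2), of q]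
    by (simp add: tau_def v_def)
  \<comment> \<open>The relation for \<open>\<phi> 2\<close> after \<open>\<phi> 3\<close>,
    evaluated at \<open>\<xi> 1\<close>; both signs come from \<open>tau 1 = -1\<close>.\<close>
  have "\<phi> 2 q ((- 1) *\<^sub>R \<xi> 2 q) = - v"
    using mixed_perm_phi[OF m e(2) x[OF i(1)]] mixed_perm_xi[OF m e(3), of q] mixed_perm_eta[OF m e(3), of q]
    by (simp add: tau_def v_def)
  then have 2: "\<phi> 2 q (\<xi> 2 q) = v"
    using tensor_field_11_scale[OF mixed_tensor[OF m i(2)] x[OF i(2)] x[OF i(2)], of "-1"] by simp
  have mult: "v = \<eta> \<beta> q v *\<^sub>R \<xi> \<beta> q" if \<beta>: "\<beta> \<in> {1,2,3}" and eq: "\<phi> \<beta> q (\<xi> \<beta> q) = v" for \<beta>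
  proof -
    have "\<phi> \<beta> q v = 0"
      using mixed_phi_phi[OF m \<beta> x[OF \<beta>]] mixed_eta_xi[OF m \<beta>] eq by simp
    moreover have "\<phi> \<beta> q (0 *\<^sub>R v) = 0 *\<^sub>R \<phi> \<beta> q v"
      by (rule tensor_field_11_scale[OF mixed_tensor[OF m \<beta>] v v])
    ultimately have "tau \<beta> *\<^sub>R (- v + \<eta> \<beta> q v *\<^sub>R \<xi> \<beta> q) = 0"
      using mixed_phi_phi[OF m \<beta> v] by simp
    then show ?thesis by (simp add: tau_def split: if_splits)
  qed
  \<comment> \<open>As a multiple of \<open>\<xi> 2\<close> the vector \<open>v\<close> is
    annihilated by \<open>\<eta> 1\<close>; this is precisely its coefficient as a multiple of
    \<open>\<xi> 1\<close>.\<close>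
  have "\<eta> 1 q v = \<eta> 2 q v * \<eta> 1 q (\<xi> 2 q)"
  proof -
    have "\<eta> 1 q (\<eta> 2 q v *\<^sub>R \<xi> 2 q) = \<eta> 2 q v * \<eta> 1 q (\<xi> 2 q)"
      using mixed_one_form[OF m i(1), unfolded one_form_def, THEN conjunct1, rule_format, OF x[OF i(2)] x[OF i(2)], THEN conjunct2] .
    then show ?thesis using mult[OF i(2) 2] by simp
  qed
  then have "\<eta> 1 q v = 0" using mixed_perm_eta[OF m e(1)] by simp
  then have "v = 0" using mult[OF i(1) v_def[symmetric]] by simp
  then show ?thesis using 2 3 \<alpha> v_def by auto
qed

section \<open>The two implications at a single point\<close>

context immersion_at begin

text \<open>The right-hand side of the Sasaki equation combines only \<open>\<xi> \<alpha>\<close>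
  and the direction of differentiation, and both are tangent; the differentiated field
  \<open>Y\<close> itself need not be.\<close>

lemma sasakian_cov_deriv_tangent:
  assumes sas: "mixed_3_sasakian A \<phi> \<xi> \<eta> g \<epsilon> nabla" and \<alpha>: "\<alpha> \<in> {1,2,3}"
    and tan: "tangent_to_structure_fields B A \<xi> f"
    and U: "open U" "f p \<in> U" and Y: "vector_field A U Y"
  shows "cov_deriv_tensor nabla (\<phi> \<alpha>) (f p) (push a) Y \<in> sub_tangent B A f p"
proof -
  have "cov_deriv_tensor nabla (\<phi> \<alpha>) (f p) (push a) Y =
      tau \<alpha> *\<^sub>R (g (f p) (push a) (Y (f p)) *\<^sub>R \<xi> \<alpha> (f p) - (\<epsilon> \<alpha> * \<eta> \<alpha> (f p) (Y (f p))) *\<^sub>R push a)"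
    using bspec[OF sas[unfolded mixed_3_sasakian_def, THEN conjunct2, THEN conjunct2, THEN conjunct2] \<alpha>,
      rule_format, OF U(1) Y U(2) push_mem(2)] .
  moreover have "\<xi> \<alpha> (f p) \<in> sub_tangent B A f p"
    using tan \<alpha> by (auto simp: tangent_to_structure_fields_def)
  ultimately show ?thesis
    by (simp only:) (intro subspace_scale subspace_diff subspace_sub_tangent push_mem)
qed

lemma invariant_imp_sff_tangent:
  assumes sas: "mixed_3_sasakian A \<phi> \<xi> \<eta> g \<epsilon> nabla"
    and tan: "tangent_to_structure_fields B A \<xi> f" and inv: "invariant_submanifold B A \<phi> f"
  shows "sff nabla a e \<in> range (J x0)"
proof -
  let ?T = "sub_tangent B A f p"
  have lc: "levi_civita_connection A g nabla" and m: "mixed_3_structure A \<phi> \<xi> \<eta>"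
    using sas by (auto simp: mixed_3_sasakian_def metric_mixed_3_structure_def)
  have nabla: "affine_connection A nabla" using lc by (simp add: levi_civita_connection_def)
  define h where "h a e = tangent_vector A c (f p) (sff nabla a e)" for a e
  have hT: "h a e \<in> tangent_space A (f p)" for a e
    unfolding h_def by (rule A.tangent_vector_mem[OF c(1)])
  have hsym: "h a e = h e a" for a e unfolding h_def by (simp add: sff_symmetric[OF lc, of a e])
  have inv': "\<phi> \<alpha> (f q) ` sub_tangent B A f q \<subseteq> sub_tangent B A f q" if "\<alpha> \<in> {1,2,3}" for \<alpha> q
    by (rule inv[unfolded invariant_submanifold_def, THEN spec, THEN bspec, OF that])
  have fp: "f p \<in> chart_dom c" using c by (auto simp: charts_at_def)
  have step: "\<phi> \<alpha> (f p) (h a e) - h a e' \<in> ?T"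
    if \<alpha>: "\<alpha> \<in> {1,2,3}" and e': "\<phi> \<alpha> (f p) (push e) = push e'" for \<alpha> a e e'
    unfolding h_def
    by (rule tensor_sff[OF nabla mixed_tensor[OF m \<alpha>] inv'[OF \<alpha>] _ e'])
      (rule sasakian_cov_deriv_tangent[OF sas \<alpha> tan A.open_dom[OF c(2)] fp A.vector_field_coordinate[OF c(2)]])
  have img: "\<exists>e'. \<phi> \<alpha> (f p) (push e) = push e'" if "\<alpha> \<in> {1,2,3}" for \<alpha> e
    using inv'[OF that, of p] push_mem(1)[of e] unfolding sub_tangent_eq_range_push by blast
  have i: "1 \<in> {1,2,3::nat}" "2 \<in> {1,2,3::nat}" "3 \<in> {1,2,3::nat}" by auto
  have phidiff: "\<phi> \<alpha> (f p) (u - v) = \<phi> \<alpha> (f p) u - \<phi> \<alpha> (f p) v"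
    if \<alpha>: "\<alpha> \<in> {1,2,3}" and uv: "u \<in> tangent_space A (f p)" "v \<in> tangent_space A (f p)" for \<alpha> u v
    using tensor_field_11_add[OF mixed_tensor[OF m \<alpha>] subspace_diff[OF A.subspace_tangent_space uv] uv(2)]
    by (simp add: algebra_simps)
  \<comment> \<open>Symmetry moves the first slot into the second, where \<open>step\<close>
    applies; \<open>\<phi> \<beta>\<close> preserves the error term by invariance, and
    \<open>step\<close> applies once more in the other slot.\<close>
  have two: "\<phi> \<beta> (f p) (\<phi> \<alpha> (f p) (h a e)) - h a' e' \<in> ?T"
    if \<alpha>: "\<alpha> \<in> {1,2,3}" and \<beta>: "\<beta> \<in> {1,2,3}"
      and a': "\<phi> \<alpha> (f p) (push a) = push a'" and e': "\<phi> \<beta> (f p) (push e) = push e'" for \<alpha> \<beta> a e a' e'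
  proof -
    have "\<phi> \<alpha> (f p) (h a e) - h a' e \<in> ?T"
      using step[OF \<alpha> a', of e] by (simp add: hsym)
    then have "\<phi> \<beta> (f p) (\<phi> \<alpha> (f p) (h a e) - h a' e) \<in> ?T" using inv'[OF \<beta>] by blast
    then have "\<phi> \<beta> (f p) (\<phi> \<alpha> (f p) (h a e)) - \<phi> \<beta> (f p) (h a' e) \<in> ?T"
      by (simp only: phidiff[OF \<beta> tensor_field_11_mem[OF mixed_tensor[OF m \<alpha>] hT] hT])
    from subspace_add[OF subspace_sub_tangent this step[OF \<beta> e', of a']] show ?thesis by simp
  qed
  have x: "\<xi> \<alpha> (f p) \<in> ?T" if "\<alpha> \<in> {1,2,3}" for \<alpha>
    using tan that by (auto simp: tangent_to_structure_fields_def)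
  obtain a1 where a1: "\<phi> 1 (f p) (push a) = push a1" using img[OF i(1)] by blast
  obtain e2 where e2: "\<phi> 2 (f p) (push e) = push e2" using img[OF i(2)] by blast
  have 21: "\<phi> 2 (f p) (\<phi> 1 (f p) (h a e)) - h a1 e2 \<in> ?T" by (rule two[OF i(1,2) a1 e2])
  \<comment> \<open>Now \<open>\<phi> 2\<close> acts first, so the slots of \<open>h\<close> are
    exchanged; symmetry returns the same vector \<open>h a1 e2\<close>.\<close>
  have 12: "\<phi> 1 (f p) (\<phi> 2 (f p) (h a e)) - h a1 e2 \<in> ?T"
    using two[OF i(2,1) e2 a1] by (simp only: hsym[of e] hsym[of e2])
  have perm: "(1, 2, 3) \<in> even_perms" by (simp add: even_perms_def)
  note S = subspace_sub_tangent
  let ?u = "\<phi> 3 (f p) (h a e)"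
  \<comment> \<open>The sum of the relations for the two products of \<open>\<phi> 1\<close> and
    \<open>\<phi> 2\<close>. Subtracting and adding \<open>h a1 e2\<close> leaves only tangent
    vectors on the right.\<close>
  have "2 *\<^sub>R ?u = (\<phi> 1 (f p) (\<phi> 2 (f p) (h a e)) - h a1 e2) - (\<phi> 2 (f p) (\<phi> 1 (f p) (h a e)) - h a1 e2)
      + \<eta> 2 (f p) (h a e) *\<^sub>R \<xi> 1 (f p) - \<eta> 1 (f p) (h a e) *\<^sub>R \<xi> 2 (f p)"
  proof -
    have "\<phi> 1 (f p) (\<phi> 2 (f p) (h a e)) + \<eta> 2 (f p) (h a e) *\<^sub>R \<xi> 1 (f p) = ?u"
      using mixed_perm_phi[OF m perm hT, of a e] by (simp add: tau_def)
    moreover have "- \<phi> 2 (f p) (\<phi> 1 (f p) (h a e)) - \<eta> 1 (f p) (h a e) *\<^sub>R \<xi> 2 (f p) = ?u"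
      using mixed_perm_phi'[OF m perm hT, of a e] by (simp add: tau_def)
    ultimately have "?u + ?u = (\<phi> 1 (f p) (\<phi> 2 (f p) (h a e)) + \<eta> 2 (f p) (h a e) *\<^sub>R \<xi> 1 (f p))
        + (- \<phi> 2 (f p) (\<phi> 1 (f p) (h a e)) - \<eta> 1 (f p) (h a e) *\<^sub>R \<xi> 2 (f p))" by (simp only:)
    then show ?thesis by (simp add: scaleR_2)
  qed
  then have "2 *\<^sub>R ?u \<in> ?T"
    using subspace_diff[OF S subspace_add[OF S subspace_diff[OF S 12 21] subspace_scale[OF S x[OF i(1)]]]
      subspace_scale[OF S x[OF i(2)]]] by (simp only:)
  then have "(1/2) *\<^sub>R 2 *\<^sub>R ?u \<in> ?T" by (rule subspace_scale[OF subspace_sub_tangent])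
  then have "?u \<in> ?T" by simp
  then have "\<phi> 3 (f p) ?u \<in> ?T" using inv'[OF i(3)] by blast
  \<comment> \<open>Since \<open>tau 3 = 1\<close>, this difference is \<open>h a e\<close>
    itself.\<close>
  then have "\<eta> 3 (f p) (h a e) *\<^sub>R \<xi> 3 (f p) - \<phi> 3 (f p) ?u \<in> ?T"
    by (intro subspace_scale subspace_diff subspace_sub_tangent x i)
  then have "h a e \<in> ?T" using mixed_phi_phi[OF m i(3) hT, of a e] by (simp add: tau_def)
  then show ?thesis by (simp add: h_def tangent_vector_sub_tangent)
qed

lemma sff_tangent_imp_invariant:
  assumes sas: "mixed_3_sasakian A \<phi> \<xi> \<eta> g \<epsilon> nabla"
    and tan: "tangent_to_structure_fields B A \<xi> f"
    and geo: "\<And>a e. sff nabla a e \<in> range (J x0)" and \<alpha>: "\<alpha> \<in> {1,2,3}"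
  shows "\<phi> \<alpha> (f p) ` sub_tangent B A f p \<subseteq> sub_tangent B A f p"
proof -
  let ?T = "sub_tangent B A f p"
  have m: "mixed_3_structure A \<phi> \<xi> \<eta>" and nabla: "affine_connection A nabla" and eps: "\<epsilon> \<alpha> \<in> {1, -1}"
    using sas \<alpha> by (auto simp: mixed_3_sasakian_def metric_mixed_3_structure_def levi_civita_connection_def)
  note X = mixed_vector_field[OF m \<alpha>] and T = mixed_tensor[OF m \<alpha>]
  have x: "\<xi> \<alpha> (f q) \<in> sub_tangent B A f q" for q
    using tan \<alpha> by (auto simp: tangent_to_structure_fields_def)
  have xT: "\<xi> \<alpha> (f p) \<in> tangent_space A (f p)" using x sub_tangent_p_iff by blast
  obtain e where e: "\<xi> \<alpha> (f p) c = J x0 e" using x[of p] by (auto simp: sub_tangent_p_iff)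
  have "\<phi> \<alpha> (f p) (push a) \<in> ?T" for a
  proof -
    let ?n = "nabla (f p) (push a) (\<xi> \<alpha>)"
    have nT: "?n \<in> tangent_space A (f p)"
      by (rule A.connection_mem[OF nabla open_UNIV UNIV_I X push_mem(2)])
    have "?n c - sff nabla a e \<in> range (J x0)"
      by (rule connection_tangent_field[OF nabla open_UNIV UNIV_I X x e])
    from subspace_add[OF subspace_range_J this geo[of a e]] have n: "?n \<in> ?T"
      using nT by (simp add: sub_tangent_p_iff)
    have "cov_deriv_tensor nabla (\<phi> \<alpha>) (f p) (push a) (\<xi> \<alpha>) =
      tau \<alpha> *\<^sub>R (g (f p) (push a) (\<xi> \<alpha> (f p)) *\<^sub>R \<xi> \<alpha> (f p) - (\<epsilon> \<alpha> * \<eta> \<alpha> (f p) (\<xi> \<alpha> (f p))) *\<^sub>R push a)"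
      using bspec[OF sas[unfolded mixed_3_sasakian_def, THEN conjunct2, THEN conjunct2, THEN conjunct2] \<alpha>,
        rule_format, OF open_UNIV X UNIV_I push_mem(2)] .
    \<comment> \<open>The first term of the covariant derivative is the derivative of
      \<open>\<phi> \<alpha> (\<xi> \<alpha>)\<close>, a field that vanishes identically.\<close>
    moreover have "cov_deriv_tensor nabla (\<phi> \<alpha>) (f p) (push a) (\<xi> \<alpha>) = - \<phi> \<alpha> (f p) ?n"
      unfolding cov_deriv_tensor_def A.mixed_phi_xi[OF m \<alpha>]
      using A.connection_zero[OF nabla open_UNIV UNIV_I push_mem(2)] by simp
    ultimately have "- \<phi> \<alpha> (f p) ?n =
      tau \<alpha> *\<^sub>R (g (f p) (push a) (\<xi> \<alpha> (f p)) *\<^sub>R \<xi> \<alpha> (f p) - \<epsilon> \<alpha> *\<^sub>R push a)"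
      by (simp add: mixed_eta_xi[OF m \<alpha>])
    from arg_cong[OF this, of uminus]
    have r: "\<phi> \<alpha> (f p) ?n =
      (- tau \<alpha> * g (f p) (push a) (\<xi> \<alpha> (f p))) *\<^sub>R \<xi> \<alpha> (f p) + (tau \<alpha> * \<epsilon> \<alpha>) *\<^sub>R push a"
      by (simp add: scaleR_diff_right)
    have sc: "s *\<^sub>R u \<in> tangent_space A (f p)" if "u \<in> tangent_space A (f p)" for s u
      by (rule subspace_scale[OF A.subspace_tangent_space that])
    \<comment> \<open>A further application of \<open>\<phi> \<alpha>\<close> removes the multiple
      of \<open>\<xi> \<alpha>\<close> and produces the vector in question, up to the sign
      \<open>tau \<alpha> * \<epsilon> \<alpha>\<close>.\<close>
    have "\<phi> \<alpha> (f p) (\<phi> \<alpha> (f p) ?n) = (tau \<alpha> * \<epsilon> \<alpha>) *\<^sub>R \<phi> \<alpha> (f p) (push a)"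
      unfolding r tensor_field_11_add[OF T sc[OF xT] sc[OF push_mem(2)]]
        tensor_field_11_scale[OF T xT xT] tensor_field_11_scale[OF T push_mem(2) push_mem(2)]
        A.mixed_phi_xi[OF m \<alpha>] by simp
    then have "(tau \<alpha> * \<epsilon> \<alpha>) *\<^sub>R \<phi> \<alpha> (f p) (push a) = tau \<alpha> *\<^sub>R (\<eta> \<alpha> (f p) ?n *\<^sub>R \<xi> \<alpha> (f p) - ?n)"
      using mixed_phi_phi[OF m \<alpha> nT] by simp
    also have "\<dots> \<in> ?T" by (intro subspace_scale subspace_diff subspace_sub_tangent x n)
    finally have "(1 / (tau \<alpha> * \<epsilon> \<alpha>)) *\<^sub>R (tau \<alpha> * \<epsilon> \<alpha>) *\<^sub>R \<phi> \<alpha> (f p) (push a) \<in> ?T"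
      by (rule subspace_scale[OF subspace_sub_tangent])
    moreover have "tau \<alpha> * \<epsilon> \<alpha> \<noteq> 0" using eps by (auto simp: tau_def)
    ultimately show ?thesis by simp
  qed
  then show ?thesis by (auto simp: sub_tangent_eq_range_push)
qed

end

theorem proposition5p5:
  fixes A :: "('m::{t2_space,second_countable_topology}, 'e::euclidean_space) chart set"
    and \<phi> :: "nat \<Rightarrow> 'm \<Rightarrow> ('m, 'e) tvec \<Rightarrow> ('m, 'e) tvec"
    and \<xi> :: "nat \<Rightarrow> 'm \<Rightarrow> ('m, 'e) tvec"
    and \<eta> :: "nat \<Rightarrow> 'm \<Rightarrow> ('m, 'e) tvec \<Rightarrow> real"
    and g :: "'m \<Rightarrow> ('m, 'e) tvec \<Rightarrow> ('m, 'e) tvec \<Rightarrow> real"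
    and \<epsilon> :: "nat \<Rightarrow> real"
    and nabla :: "('m, 'e) conn"
    and B :: "('s::{t2_space,second_countable_topology}, 'd::euclidean_space) chart set"
    and f :: "'s \<Rightarrow> 'm"
  assumes "mixed_3_sasakian A \<phi> \<xi> \<eta> g \<epsilon> nabla"
    and "immersed_submanifold B A f"
    and "nondegenerate_submanifold B A g f"
    and "tangent_to_structure_fields B A \<xi> f"
  shows "totally_geodesic B A g nabla f \<longleftrightarrow> invariant_submanifold B A \<phi> f"
proof -
  have im: "immersion_at A B f"
    using assms(1,2) by unfold_locales (auto simp: mixed_3_sasakian_def immersed_submanifold_def)
  have metric: "semi_riemannian_metric A g" and nabla: "affine_connection A nabla"
    using assms(1)
    by (auto simp: mixed_3_sasakian_def metric_mixed_3_structure_def levi_civita_connection_def)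
  show ?thesis
  proof
    assume tg: "totally_geodesic B A g nabla f"
    show "invariant_submanifold B A \<phi> f"
      unfolding invariant_submanifold_def
      using immersion_at.sff_tangent_imp_invariant[OF im assms(1,4)
        immersion_at.totally_geodesic_sff[OF im metric assms(3) nabla tg]]
      by (intro allI ballI)
  next
    assume inv: "invariant_submanifold B A \<phi> f"
    show "totally_geodesic B A g nabla f"
      unfolding totally_geodesic_def
    proof (intro allI impI ballI)
      fix V X Y p
      assume V: "open V" and XY: "vector_field B V X" "vector_field B V Y" and p: "p \<in> V"
      show "second_fundamental_form B A g nabla f X Y p = 0"
        unfolding immersion_at.second_fundamental_form_eq_0_iff[OF im metric assms(3) nabla V p XY]
        by (rule immersion_at.invariant_imp_sff_tangent[OF im assms(1,4) inv])
    qed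
  qed
qed

end
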